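(* Let $G\subset\mathbb{C}$ be a continuum (connected compact set, not a single point) with $\tilde{\mathbb{C}}\setminus G$ connected, and let $R>1$ be such that $f$ and $g$ are analytic in $G_{R}$, with Faber expansions $f(z)=\sum_{k=0}^{\infty}a_{k}(f)F_{k}(z)$, $g(z)=\sum_{k=0}^{\infty}a_{k}(g)F_{k}(z)$ for $z\in G_{R}$. Suppose that for each $h\in\{f,g,fg\}$ the function $H$ associated with $h$ (see context) extends continuously to $\overline{\mathbb{D}_{1}}$. Let $1<r<R$. (i) There is a constant $C$ depending on $f,g,r$ but not on $n$ such that for all $z\in\overline{G_{r}}$ and $n\in\mathbb{N}$, $$|\mathcal{B}_{n}(fg;G)(z)-\mathcal{B}_{n}(f;G)(z)\,\mathcal{B}_{n}(g;G)(z)|\le\frac{C}{n}.$$ (ii) There is a constant $C$ depending on $f,g,r$ but not on $n$ such that for all $z\in\overline{G_{r}}$ and $n\in\mathbb{N}$, $$\Big|\mathcal{B}_{n}(fg;G)(z)-\mathcal{B}_{n}(f;G)(z)\,\mathcal{B}_{n}(g;G)(z)-\sum_{k=2}^{\infty}\frac{k(k-1)}{2n}[F_{k-1}(z)-F_{k}(z)]\,[a_{k}(fg)-f(z)a_{k}(g)-g(z)a_{k}(f)]\Big|\le\frac{C}{n^{2}}.$$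
   Context: Let $G\subset\mathbb{C}$ be compact with $\tilde{\mathbb{C}}\setminus G$ connected ($\tilde{\mathbb{C}}$ the extended plane). Let $\Psi$ be the unique conformal map of $\tilde{\mathbb{C}}\setminus\overline{\mathbb{D}_{1}}$ onto $\tilde{\mathbb{C}}\setminus G$ with $\Psi(\infty)=\infty$, $\Psi'(\infty)>0$, where $\mathbb{D}_{1}=\{|w|<1\}$, and $\Phi=\Psi^{-1}$. The Faber polynomials $F_{n}$ of $G$ are defined by $\frac{\Psi'(w)}{\Psi(w)-z}=\sum_{n=0}^{\infty}\frac{F_{n}(z)}{w^{n+1}}$, $z\in G$, $|w|>1$. For $R>1$, $\Gamma_{R}=\{\Psi(w):|w|=R\}=\{z:|\Phi(z)|=R\}$ and $G_{R}$ is the interior of $\Gamma_{R}$ (so $G\subset\overline{G_{r}}$ for $1<r<R$). For $h$ analytic on $G_{R}$, the Faber coefficients are $a_{n}(h)=\frac{1}{2\pi i}\int_{|u|=1}\frac{h(\Psi(u))}{u^{n+1}}du$, $n\ge0$. The function associated with $h$ is $H(w)=\frac{1}{2\pi i}\int_{|u|=1}\frac{h(\Psi(u))}{u-w}du$, $w\in\mathbb{D}_{1}$. The Bernstein-Faber polynomials are $$\mathcal{B}_{n}(h;G)(z)=\sum_{p=0}^{n}\binom{n}{p}\Delta_{1/n}^{p}H(0)\,F_{p}(z),\qquad \Delta_{t}^{p}H(0)=\sum_{k=0}^{p}(-1)^{p-k}\binom{p}{k}H(kt),$$ which requires $H$ to be continuous up to $w=1$. *)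

theory Defs
  imports "HOL-Complex_Analysis.Complex_Analysis" "HOL-Computational_Algebra.Polynomial"
begin

text \<open>Psi is the normalized exterior conformal map of the complement of the closed unit
disk onto the complement of G: holomorphic, injective, onto the complement of G,
with Psi(infinity) = infinity and Psi'(infinity) > 0 (i.e. Psi(w)/w tends to a positive real).\<close>
definition exterior_conformal_map :: "complex set \<Rightarrow> (complex \<Rightarrow> complex) \<Rightarrow> bool" where
  "exterior_conformal_map G Psi \<longleftrightarrow>
     Psi holomorphic_on {w. 1 < norm w} \<and>
     inj_on Psi {w. 1 < norm w} \<and>
     Psi ` {w. 1 < norm w} = - G \<and>
     (\<exists>c::real. c > 0 \<and> ((\<lambda>w. Psi w / w) \<longlongrightarrow> complex_of_real c) at_infinity)"

text \<open>G_R: the interior of the level curve Gamma_R = Psi(|w| = R).\<close>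
definition GR :: "(complex \<Rightarrow> complex) \<Rightarrow> complex set \<Rightarrow> real \<Rightarrow> complex set" where
  "GR Psi G R = G \<union> Psi ` {w. 1 < norm w \<and> norm w < R}"

definition faber_poly :: "complex set \<Rightarrow> (complex \<Rightarrow> complex) \<Rightarrow> nat \<Rightarrow> complex poly" where
  "faber_poly G Psi = (SOME P. \<forall>z\<in>G. \<forall>w. 1 < norm w \<longrightarrow>
       (\<lambda>n. poly (P n) z / w ^ Suc n) sums (deriv Psi w / (Psi w - z)))"

text \<open>Faber coefficients; the integral over |u| = 1 is taken as the limit of the
integrals over |u| = rho as rho tends to 1 from above.\<close>
definition faber_coeff :: "(complex \<Rightarrow> complex) \<Rightarrow> (complex \<Rightarrow> complex) \<Rightarrow> nat \<Rightarrow> complex" where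
  "faber_coeff Psi h n = Lim (at_right (1::real))
     (\<lambda>\<rho>. contour_integral (circlepath 0 \<rho>) (\<lambda>u. h (Psi u) / u ^ Suc n) / (2 * of_real pi * \<i>))"

definition assoc_H :: "(complex \<Rightarrow> complex) \<Rightarrow> (complex \<Rightarrow> complex) \<Rightarrow> complex \<Rightarrow> complex" where
  "assoc_H Psi h w = Lim (at_right (1::real))
     (\<lambda>\<rho>. contour_integral (circlepath 0 \<rho>) (\<lambda>u. h (Psi u) / (u - w)) / (2 * of_real pi * \<i>))"

definition assoc_ext :: "(complex \<Rightarrow> complex) \<Rightarrow> (complex \<Rightarrow> complex) \<Rightarrow> complex \<Rightarrow> complex" where
  "assoc_ext Psi h w = (if norm w < 1 then assoc_H Psi h w
                        else Lim (at w within ball 0 1) (assoc_H Psi h))"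

definition fwd_diff :: "(complex \<Rightarrow> complex) \<Rightarrow> real \<Rightarrow> nat \<Rightarrow> complex" where
  "fwd_diff H t p = (\<Sum>k=0..p. (-1) ^ (p - k) * of_nat (p choose k) * H (of_real (real k * t)))"

definition bernstein_faber ::
  "complex set \<Rightarrow> (complex \<Rightarrow> complex) \<Rightarrow> (complex \<Rightarrow> complex) \<Rightarrow> nat \<Rightarrow> complex \<Rightarrow> complex" where
  "bernstein_faber G Psi h n z =
     (\<Sum>p=0..n. of_nat (n choose p) * fwd_diff (assoc_ext Psi h) (1 / real n) p
                 * poly (faber_poly G Psi p) z)"

end

theory Submission
  imports Defs
begin

text \<open>Writing \<open>H(w) = \<Sum>\<^sub>k a\<^sub>k w\<^sup>k\<close>, the operator \<open>B\<^sub>n\<close> replaces \<open>F\<^sub>k\<close> in the Faber series of \<open>h\<close> by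
  the mean of \<open>F\<^sub>N\<close>, where \<open>N\<close> is the number of occupied boxes after \<open>k\<close> balls are thrown into
  \<open>n\<close> boxes. Up to \<open>O(k^4/n^2)\<close>, \<open>N = k - 1\<close> has probability \<open>k(k-1)/(2n)\<close> and otherwise
  \<open>N = k\<close>. On the closure of \<open>G\<^sub>r\<close> one has \<open>|F\<^sub>k| \<le> M s^k\<close> for any \<open>s > r\<close>, and \<open>a\<^sub>k\<close> is
  \<open>O(s'^(-k))\<close> for any \<open>s' < R\<close>, so \<open>B\<^sub>n(h) = h + L(h)/n + O(1/n\<^sup>2)\<close> uniformly. Multiplying these
  expansions for \<open>f\<close>, \<open>g\<close> and comparing with the one for \<open>f g\<close> gives both claims.\<close>

subsection \<open>The occupancy distribution\<close>

text \<open>The probability that \<open>k\<close> balls thrown into \<open>n\<close> boxes occupy exactly \<open>p\<close> of them,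
  by conditioning on the last ball.\<close>

primrec occupancy :: "nat \<Rightarrow> nat \<Rightarrow> nat \<Rightarrow> real" where
  "occupancy n 0 p = (if p = 0 then 1 else 0)"
| "occupancy n (Suc k) p = real p / real n * occupancy n k p
     + (if p = 0 then 0 else (real n - real (p - 1)) / real n * occupancy n k (p - 1))"

lemma occupancy_eq_0: "k < p \<Longrightarrow> occupancy n k p = 0"
  by (induction k arbitrary: p) auto

lemma occupancy_eq_0': "0 < n \<Longrightarrow> n < p \<Longrightarrow> occupancy n k p = 0"
proof (induction k arbitrary: p)
  case (Suc k)
  \<comment> \<open>For \<open>p = Suc n\<close> the previous row may be nonzero at
    \<open>p - 1 = n\<close>, but its weight \<open>n - (p - 1)\<close> is zero there; larger
    \<open>p\<close> follow by induction.\<close>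
  then show ?case by (cases "p = Suc n") auto
qed auto

lemma occupancy_nonneg: "0 < n \<Longrightarrow> 0 \<le> occupancy n k p"
proof (induction k arbitrary: p)
  case (Suc k)
  show ?case
  \<comment> \<open>The weight \<open>n - (p - 1)\<close> may be negative when \<open>p\<close>
    exceeds \<open>n\<close>, but there the value is already known to be zero.\<close>
  proof (cases "p \<le> n")
    case True
    then show ?thesis using Suc by (auto intro!: add_nonneg_nonneg mult_nonneg_nonneg)
  next
    case False
    then show ?thesis using Suc.prems occupancy_eq_0'[of n p "Suc k"] by simp
  qed
qed auto

lemma occupancy_diag:
  "0 < n \<Longrightarrow> occupancy n (Suc k) (Suc k) = (1 - real k / real n) * occupancy n k k"
  by (simp add: occupancy_eq_0 field_simps)

text \<open>Conservation of mass: state \<open>p\<close> passes the share p/n to itself and (n -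
  p)/n to p + 1, and these shares add up to 1.\<close>

lemma sum_occupancy:
  assumes "0 < n"
  shows "(\<Sum>p\<le>k. occupancy n k p) = 1"
proof (induction k)
  case (Suc k)
  have "(\<Sum>p\<le>Suc k. occupancy n (Suc k) p)
      = (\<Sum>p\<le>Suc k. real p / real n * occupancy n k p)
        + (\<Sum>p\<le>Suc k. if p = 0 then 0 else (real n - real (p - 1)) / real n * occupancy n k (p - 1))"
    by (simp add: sum.distrib del: sum.atMost_Suc)
  also have "(\<Sum>p\<le>Suc k. real p / real n * occupancy n k p)
      = (\<Sum>p\<le>k. real p / real n * occupancy n k p)"
    by (simp add: occupancy_eq_0)
  also have "(\<Sum>p\<le>Suc k. if p = 0 then 0 else (real n - real (p - 1)) / real n * occupancy n k (p - 1))
      = (\<Sum>p\<le>k. (real n - real p) / real n * occupancy n k p)"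
    by (subst sum.atMost_Suc_shift) simp
  also have "(\<Sum>p\<le>k. real p / real n * occupancy n k p)
      + (\<Sum>p\<le>k. (real n - real p) / real n * occupancy n k p) = (\<Sum>p\<le>k. occupancy n k p)"
    using assms by (simp add: sum.distrib[symmetric] field_simps)
  finally show ?case using Suc by simp
qed auto

text \<open>The bridge from finite differences to probability. Both sides obey the same recurrence
  in \<open>k\<close>: the extra factor j/n is absorbed by j C(p,j) = p (C(p,j) - C(p-1,j)), which
  yields the differences of orders \<open>p\<close> and \<open>p - 1\<close>, and p C(n,p) = (n - p
  + 1) C(n,p-1) then turns the weights into those of \<open>occupancy\<close>.\<close>

lemma binomial_fwd_diff_power:
  assumes "0 < n"
  shows "of_nat (n choose p) * fwd_diff (\<lambda>x. x ^ k) (1 / real n) p = of_real (occupancy n k p)"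
proof (induction k arbitrary: p)
  case 0
  have "(\<Sum>j\<le>p. (-1) ^ (p - j) * of_nat (p choose j)) = (if p = 0 then 1 else 0 :: complex)"
    using binomial_ring[of 1 "-1::complex" p] by (simp add: mult.commute power_0_left)
  then show ?case
    by (simp add: fwd_diff_def atLeast0AtMost)
next
  case (Suc k)
  let ?D = "\<lambda>k p. fwd_diff (\<lambda>x. x ^ k) (1 / real n) p"
  let ?x = "\<lambda>j. of_real (real j / real n) :: complex"
  show ?case
  proof (cases p)
    case 0
    then show ?thesis by (simp add: fwd_diff_def)
  next
    case p: (Suc m)
    have split: "of_nat (p choose j) * ?x j
        = of_nat p / of_nat n * (of_nat (p choose j) - of_nat (m choose j))" if "j \<le> p" for j
    proof -
      have "(p - j) * (p choose j) = p * (m choose j)"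
        using binomial_absorb_comp[of p j] p by simp
      then have "of_nat (p - j) * of_nat (p choose j) = (of_nat p * of_nat (m choose j) :: complex)"
        by (metis of_nat_mult)
      then have "(of_nat p - of_nat j) * of_nat (p choose j) = (of_nat p * of_nat (m choose j) :: complex)"
        using that by (simp add: of_nat_diff)
      then show ?thesis using assms by (simp add: field_simps)
    qed
    have "?D (Suc k) p = (\<Sum>j\<le>p. (-1) ^ (p - j) * (of_nat (p choose j) * ?x j) * ?x j ^ k)"
      by (simp add: fwd_diff_def atLeast0AtMost mult_ac del: sum.atMost_Suc)
    also have "\<dots> = (\<Sum>j\<le>p. (-1) ^ (p - j) * (of_nat p / of_nat n * (of_nat (p choose j) - of_nat (m choose j))) * ?x j ^ k)"
      by (intro sum.cong refl) (subst split, auto)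
    also have "\<dots> = of_nat p / of_nat n * ((\<Sum>j\<le>p. (-1) ^ (p - j) * of_nat (p choose j) * ?x j ^ k)
         - (\<Sum>j\<le>p. (-1) ^ (p - j) * of_nat (m choose j) * ?x j ^ k))"
      by (simp add: sum_distrib_left sum_subtractf[symmetric] algebra_simps del: sum.atMost_Suc)
    \<comment> \<open>The term j = p drops out because C(m,p) = 0 for p = m + 1, and lowering the
      exponent from \<open>p - j\<close> to \<open>m - j\<close> flips the sign.\<close>
    also have "(\<Sum>j\<le>p. (-1) ^ (p - j) * of_nat (m choose j) * ?x j ^ k)
         = (\<Sum>j\<le>m. - ((-1) ^ (m - j) * of_nat (m choose j) * ?x j ^ k))"
      unfolding p by (simp add: Suc_diff_le)
    also have "(\<Sum>j\<le>p. (-1) ^ (p - j) * of_nat (p choose j) * ?x j ^ k)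
         - (\<Sum>j\<le>m. - ((-1) ^ (m - j) * of_nat (m choose j) * ?x j ^ k)) = ?D k p + ?D k m"
      by (simp add: fwd_diff_def atLeast0AtMost sum_negf del: sum.atMost_Suc)
    finally have D: "?D (Suc k) p = of_nat p / of_nat n * (?D k p + ?D k m)" .
    have ch: "of_nat (n choose p) * of_nat p = (of_nat n - of_nat m) * (of_nat (n choose m) :: complex)"
    proof (cases "m \<le> n")
      case True
      have "(n choose p) * p = (n choose m) * (n - m)"
        unfolding p using binomial_absorb_comp[of n m] binomial_absorption[of m n]
        by (simp add: mult.commute)
      then have "of_nat (n choose p) * of_nat p = (of_nat (n choose m) * of_nat (n - m) :: complex)"
        by (metis of_nat_mult)
      then show ?thesis using True by (simp add: of_nat_diff mult.commute)
    qed (auto simp: p binomial_eq_0)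
    have "of_nat (n choose p) * ?D (Suc k) p
      = of_nat p / of_nat n * (of_nat (n choose p) * ?D k p)
        + (of_nat (n choose p) * of_nat p) / of_nat n * ?D k m"
      unfolding D by (simp add: algebra_simps add_divide_distrib)
    also have "\<dots> = of_nat p / of_nat n * of_real (occupancy n k p)
        + (of_nat n - of_nat m) / of_nat n * of_real (occupancy n k m)"
      unfolding ch Suc[of p, symmetric] Suc[of m, symmetric] by simp
    also have "\<dots> = of_real (occupancy n (Suc k) p)"
      by (simp add: p)
    finally show ?thesis .
  qed
qed

text \<open>By \<open>occupancy_diag\<close> the diagonal value is the product of 1 - i/n over i <
  k, whose expansion begins 1 - k(k-1)/(2n). The crude bound k^2/n drives the error recursion of the
  sharper one: each step adds at most k^3/n^2, and these add up to less than k^4/n^2.\<close>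

lemma occupancy_diag_deficit:
  assumes "0 < n"
  shows "0 \<le> 1 - occupancy n k k \<and> 1 - occupancy n k k \<le> real k ^ 2 / real n
    \<and> \<bar>1 - occupancy n k k - real k * (real k - 1) / (2 * real n)\<bar> \<le> real k ^ 4 / real n ^ 2"
proof -
  have le1: "occupancy n k k \<le> 1" for k
    using member_le_sum[of k "{..k}" "occupancy n k"] sum_occupancy[OF assms, of k]
      occupancy_nonneg[OF assms] by auto
  have A: "1 - occupancy n k k \<le> real k ^ 2 / real n" for k
  proof (induction k)
    case (Suc k)
    have "1 - occupancy n (Suc k) (Suc k) = (1 - occupancy n k k) + real k / real n * occupancy n k k"
      using occupancy_diag[OF assms, of k] by (simp add: algebra_simps)
    also have "\<dots> \<le> real k ^ 2 / real n + real k / real n * 1"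
      using Suc le1[of k] by (intro add_mono mult_left_mono) auto
    also have "\<dots> = (real k ^ 2 + real k) / real n"
      by (simp add: add_divide_distrib)
    also have "\<dots> \<le> real (Suc k) ^ 2 / real n"
      by (intro divide_right_mono) (auto simp: power2_eq_square algebra_simps)
    finally show ?case .
  qed auto
  have "\<bar>1 - occupancy n k k - real k * (real k - 1) / (2 * real n)\<bar> \<le> real k ^ 4 / real n ^ 2"
  proof (induction k)
    case (Suc k)
    \<comment> \<open>The increment k/n of k(k-1)/(2n) cancels, so the new error is the old one
      minus k/n times the previous deficit.\<close>
    have "1 - occupancy n (Suc k) (Suc k) - real (Suc k) * (real (Suc k) - 1) / (2 * real n)
        = (1 - occupancy n k k - real k * (real k - 1) / (2 * real n))
          - real k / real n * (1 - occupancy n k k)"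
      unfolding occupancy_diag[OF assms] using assms by (simp add: field_simps)
    also have "\<bar>\<dots>\<bar> \<le> real k ^ 4 / real n ^ 2 + real k / real n * (real k ^ 2 / real n)"
    proof -
      have "\<bar>real k / real n * (1 - occupancy n k k)\<bar> \<le> real k / real n * (real k ^ 2 / real n)"
        unfolding abs_mult using A[of k] le1[of k] by (intro mult_mono) auto
      then show ?thesis using Suc by linarith
    qed
    also have "\<dots> = (real k ^ 4 + real k ^ 3) / real n ^ 2"
      by (simp add: power2_eq_square power3_eq_cube add_divide_distrib)
    also have "\<dots> \<le> real (Suc k) ^ 4 / real n ^ 2"
      by (intro divide_right_mono) (auto simp: power4_eq_xxxx power3_eq_cube algebra_simps)
    finally show ?case .
  qed auto
  then show ?thesis using A le1 by auto
qed

text \<open>This is the probability of at least two collisions. One more ball increases it only if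
  exactly one collision had occurred and the ball hits one of the \<open>m\<close> occupied boxes. A
  single collision has probability at most (m+1)^2/n, so each ball contributes at most m
  (m+1)^2/n^2.\<close>

lemma sum_occupancy_tail:
  assumes "0 < n"
  shows "(\<Sum>p<k. occupancy n (Suc k) p) \<le> real (Suc k) ^ 4 / real n ^ 2"
proof (induction k)
  case (Suc m)
  have "(\<Sum>p<Suc m. occupancy n (Suc (Suc m)) p)
      = (\<Sum>p<Suc m. real p / real n * occupancy n (Suc m) p)
        + (\<Sum>p<Suc m. if p = 0 then 0 else (real n - real (p - 1)) / real n * occupancy n (Suc m) (p - 1))"
    by (simp only: occupancy.simps(2)[of n "Suc m"] sum.distrib)
  also have "(\<Sum>p<Suc m. if p = 0 then 0 else (real n - real (p - 1)) / real n * occupancy n (Suc m) (p - 1))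
      = (\<Sum>p<m. (real n - real p) / real n * occupancy n (Suc m) p)"
    by (subst sum.lessThan_Suc_shift) (simp del: occupancy.simps)
  also have "(\<Sum>p<Suc m. real p / real n * occupancy n (Suc m) p)
      + (\<Sum>p<m. (real n - real p) / real n * occupancy n (Suc m) p)
      = (\<Sum>p<m. (real p / real n + (real n - real p) / real n) * occupancy n (Suc m) p)
        + real m / real n * occupancy n (Suc m) m"
    by (simp add: sum.distrib distrib_right del: occupancy.simps)
  also have "\<dots> = (\<Sum>p<m. occupancy n (Suc m) p) + real m / real n * occupancy n (Suc m) m"
    using assms by (simp add: add_divide_distrib[symmetric] del: occupancy.simps)
  finally have step: "(\<Sum>p<Suc m. occupancy n (Suc (Suc m)) p)
      = (\<Sum>p<m. occupancy n (Suc m) p) + real m / real n * occupancy n (Suc m) m" .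
  have "occupancy n (Suc m) m \<le> real (Suc m) ^ 2 / real n"
  proof -
    have "(\<Sum>p\<in>{m, Suc m}. occupancy n (Suc m) p) \<le> (\<Sum>p\<le>Suc m. occupancy n (Suc m) p)"
      by (rule sum_mono2) (auto simp: occupancy_nonneg[OF assms] simp del: occupancy.simps)
    then have "occupancy n (Suc m) m \<le> 1 - occupancy n (Suc m) (Suc m)"
      using sum_occupancy[OF assms, of "Suc m"] by (simp del: occupancy.simps sum.atMost_Suc)
    then show ?thesis using occupancy_diag_deficit[OF assms, of "Suc m"] by linarith
  qed
  then have "(\<Sum>p<Suc m. occupancy n (Suc (Suc m)) p)
      \<le> real (Suc m) ^ 4 / real n ^ 2 + real m / real n * (real (Suc m) ^ 2 / real n)"
    unfolding step using Suc by (intro add_mono mult_left_mono) auto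
  also have "\<dots> = (real (Suc m) ^ 4 + real m * real (Suc m) ^ 2) / real n ^ 2"
    by (simp add: power2_eq_square add_divide_distrib)
  also have "\<dots> \<le> real (Suc (Suc m)) ^ 4 / real n ^ 2"
    by (intro divide_right_mono) (auto simp: power4_eq_xxxx power2_eq_square algebra_simps)
  finally show ?case .
qed auto

text \<open>The mean is split according to no collision, one collision, or more. The three weights
  deviate from 1 - x, x and 0, where x = k(k-1)/(2n), by at most e, 2e and e with e = k^4/n^2; hence
  the constant 4. The middle bound follows from the other two because the weights sum to 1.\<close>

lemma occupancy_expectation:
  fixes \<phi> :: "nat \<Rightarrow> complex"
  assumes n: "0 < n" and B: "\<And>p. p \<le> k \<Longrightarrow> norm (\<phi> p) \<le> B"
  shows "norm ((\<Sum>p\<le>k. of_real (occupancy n k p) * \<phi> p) - \<phi> k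
    - of_real (real k * (real k - 1) / (2 * real n)) * (\<phi> (k - 1) - \<phi> k)) \<le> 4 * (real k ^ 4 / real n ^ 2) * B"
proof (cases k)
  case (Suc m)
  define x where "x = real k * (real k - 1) / (2 * real n)"
  let ?u = "occupancy n k k" and ?v = "occupancy n k m"
  let ?\<rho> = "\<Sum>p<m. occupancy n k p" and ?e = "real k ^ 4 / real n ^ 2"
  have B0: "0 \<le> B" using B[of k] norm_ge_zero order_trans by blast
  have ns: "{..k} = insert k (insert m {..<m})" using Suc by auto
  have sum1: "?\<rho> + ?v + ?u = 1"
    using sum_occupancy[OF n, of k] Suc unfolding ns by (simp del: occupancy.simps)
  have rho: "0 \<le> ?\<rho>" "?\<rho> \<le> ?e"
    using sum_occupancy_tail[OF n, of m] Suc by (auto intro!: sum_nonneg occupancy_nonneg[OF n] simp del: occupancy.simps)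
  have u: "\<bar>?u - 1 + x\<bar> \<le> ?e"
    using occupancy_diag_deficit[OF n, of k] unfolding x_def by linarith
  have v: "\<bar>?v - x\<bar> \<le> 2 * ?e"
    using u sum1 rho by linarith
  have "(\<Sum>p\<le>k. of_real (occupancy n k p) * \<phi> p) - \<phi> k - of_real x * (\<phi> (k - 1) - \<phi> k)
      = of_real (?u - 1 + x) * \<phi> k + of_real (?v - x) * \<phi> m
        + (\<Sum>p<m. of_real (occupancy n k p) * \<phi> p)"
    using Suc unfolding ns by (simp add: algebra_simps del: occupancy.simps)
  also have "norm \<dots> \<le> ?e * B + (2 * ?e) * B + ?e * B"
  proof (intro norm_triangle_le[OF add_mono[OF norm_triangle_le[OF add_mono]]])
    show "norm (of_real (?u - 1 + x) * \<phi> k) \<le> ?e * B"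
      unfolding norm_mult norm_of_real using u B[of k] B0 by (intro mult_mono) auto
    show "norm (of_real (?v - x) * \<phi> m) \<le> 2 * ?e * B"
      unfolding norm_mult norm_of_real using v B[of m] B0 Suc by (intro mult_mono) auto
    have "norm (\<Sum>p<m. of_real (occupancy n k p) * \<phi> p) \<le> (\<Sum>p<m. occupancy n k p * B)"
      using B Suc occupancy_nonneg[OF n, of k]
      by (intro sum_norm_le) (auto simp: norm_mult intro!: mult_left_mono simp del: occupancy.simps)
    also have "\<dots> = ?\<rho> * B" by (simp add: sum_distrib_right)
    also have "\<dots> \<le> ?e * B" using rho B0 by (intro mult_right_mono) auto
    finally show "norm (\<Sum>p<m. of_real (occupancy n k p) * \<phi> p) \<le> ?e * B" .
  qed
  finally show ?thesis unfolding x_def by (simp add: algebra_simps)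
qed simp


subsection \<open>Integrals over circles and power series\<close>

text \<open>Concentric circles in the annulus are homotopic along radial segments, so the integral
  does not depend on the radius and the limit is that of an eventually constant function. The limits
  in \<open>faber_coeff\<close> and \<open>assoc_H\<close> thereby become integrals over any one
  circle of radius between 1 and \<open>R\<close>.\<close>

lemma Lim_circlepath_integral:
  assumes k: "k holomorphic_on {w. 1 < norm w \<and> norm w < R}" and s: "1 < s" "s < R"
  shows "Lim (at_right (1::real)) (\<lambda>\<rho>. contour_integral (circlepath 0 \<rho>) k / (2 * of_real pi * \<i>))
       = contour_integral (circlepath 0 s) k / (2 * of_real pi * \<i>)"
proof -
  let ?A = "{w::complex. 1 < norm w \<and> norm w < R}"
  have opA: "open ?A"
    by (intro open_Collect_conj open_Collect_less continuous_intros)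
  have eq: "contour_integral (circlepath 0 \<rho>) k = contour_integral (circlepath 0 s) k"
    if "1 < \<rho>" "\<rho> < R" for \<rho>
  proof (rule Cauchy_theorem_homotopic_loops[OF _ opA k])
    show "homotopic_loops ?A (circlepath 0 \<rho>) (circlepath 0 s)"
    proof (rule homotopic_loops_linear)
      fix t :: real
      show "closed_segment (circlepath 0 \<rho> t) (circlepath 0 s t) \<subseteq> ?A"
      proof
        fix x assume "x \<in> closed_segment (circlepath 0 \<rho> t) (circlepath 0 s t)"
        then obtain u where u: "0 \<le> u" "u \<le> 1"
          and x: "x = (1 - u) *\<^sub>R circlepath 0 \<rho> t + u *\<^sub>R circlepath 0 s t"
          by (auto simp: in_segment)
        have "x = of_real ((1 - u) * \<rho> + u * s) * exp (2 * of_real pi * \<i> * of_real t)"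
          unfolding x circlepath by (simp add: scaleR_conv_of_real algebra_simps)
        then have nx: "norm x = \<bar>(1 - u) * \<rho> + u * s\<bar>"
          by (simp add: norm_mult norm_exp_eq_Re del: of_real_add of_real_mult of_real_diff)
        have "(1 - u) * \<rho> + u * s \<in> closed_segment \<rho> s"
          using u by (auto simp: in_segment)
        then have "1 < (1 - u) * \<rho> + u * s \<and> (1 - u) * \<rho> + u * s < R"
          using that s by (auto simp: closed_segment_eq_real_ivl split: if_splits)
        then show "x \<in> ?A" using nx by auto
      qed
    qed auto
  qed auto
  have "((\<lambda>\<rho>. contour_integral (circlepath 0 \<rho>) k / (2 * of_real pi * \<i>))
     \<longlongrightarrow> contour_integral (circlepath 0 s) k / (2 * of_real pi * \<i>)) (at_right (1::real))"
  proof (rule tendsto_eventually)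
    have "1 < R" using s by simp
    then have "\<forall>\<^sub>F \<rho> in at_right 1. 1 < \<rho> \<and> \<rho> < R"
      by (auto simp: eventually_at_right)
    then show "\<forall>\<^sub>F \<rho> in at_right 1. contour_integral (circlepath 0 \<rho>) k / (2 * of_real pi * \<i>)
        = contour_integral (circlepath 0 s) k / (2 * of_real pi * \<i>)"
      by eventually_elim (use eq in auto)
  qed
  then show ?thesis by (intro tendsto_Lim) auto
qed

text \<open>Termwise integration by the Weierstrass M-test. It serves twice: with the geometric
  series for 1/(u - w), and with the generating series of the Faber polynomials.\<close>

lemma circlepath_integral_sums:
  fixes c :: "nat \<Rightarrow> complex"
  assumes s: "0 < s" and k: "continuous_on (sphere 0 s) k"
    and sm: "summable (\<lambda>n. norm (c n) / s ^ n)"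
    and q: "\<And>u. norm u = s \<Longrightarrow> (\<lambda>n. c n / u ^ n) sums q u"
  shows "(\<lambda>n. contour_integral (circlepath 0 s) (\<lambda>u. k u / u ^ Suc n) / (2 * of_real pi * \<i>) * c n)
      sums (contour_integral (circlepath 0 s) (\<lambda>u. k u / u * q u) / (2 * of_real pi * \<i>))"
proof -
  have nz: "u \<noteq> 0" if "norm u = s" for u :: complex using that s by auto
  have ci: "(\<lambda>u. k u / u ^ Suc n) contour_integrable_on circlepath 0 s" for n
    using s nz by (intro contour_integrable_continuous_circlepath continuous_intros)
      (auto intro: continuous_on_subset[OF k])
  define f where "f = (\<lambda>n u. k u / u ^ Suc n * c n)"
  have cf: "f n contour_integrable_on circlepath 0 s" for n
    unfolding f_def by (intro contour_integrable_rmul ci)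
  have fi: "contour_integral (circlepath 0 s) (f n)
      = contour_integral (circlepath 0 s) (\<lambda>u. k u / u ^ Suc n) * c n" for n
    unfolding f_def by (rule contour_integral_rmul[OF ci])
  obtain M where "\<forall>u\<in>sphere 0 s. norm (k u) \<le> M"
    using compact_imp_bounded[OF compact_continuous_image[OF k compact_sphere]]
    by (auto simp: bounded_iff)
  then have M: "norm (k u) \<le> M" if "norm u = s" for u
    using that by simp
  have fs: "(\<lambda>n. f n u) sums (k u / u * q u)" if "norm u = s" for u
    using sums_mult[OF q[OF that], of "k u / u"] nz[OF that] by (simp add: f_def)
  have "uniform_limit (sphere 0 s) (\<lambda>n u. \<Sum>i<n. f i u) (\<lambda>u. suminf (\<lambda>i. f i u)) sequentially"
  proof (rule Weierstrass_m_test)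
    fix n u assume u: "u \<in> sphere (0::complex) s"
    have "norm (f n u) = norm (k u) * (norm (c n) / s ^ n) / s"
      using u by (simp add: f_def norm_mult norm_divide norm_power)
    also have "\<dots> \<le> M * (norm (c n) / s ^ n) / s"
      using M[of u] u s by (intro divide_right_mono mult_right_mono) auto
    finally show "norm (f n u) \<le> M / s * (norm (c n) / s ^ n)" by (simp add: field_simps)
  next
    show "summable (\<lambda>n. M / s * (norm (c n) / s ^ n))" by (intro summable_mult sm)
  qed
  then have "uniform_limit (sphere 0 s) (\<lambda>n u. \<Sum>i<n. f i u) (\<lambda>u. k u / u * q u) sequentially"
    using fs by (subst (asm) uniform_limit_cong'[of _ _ _ _ "\<lambda>u. k u / u * q u"]) (auto simp: sums_iff)
  then have "(\<lambda>n. contour_integral (circlepath 0 s) (\<lambda>u. \<Sum>i<n. f i u))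
      \<longlonglongrightarrow> contour_integral (circlepath 0 s) (\<lambda>u. k u / u * q u)"
    using s by (intro contour_integral_uniform_limit_circlepath)
      (auto intro!: always_eventually contour_integrable_sum cf)
  then have "(\<lambda>n. contour_integral (circlepath 0 s) (f n))
      sums contour_integral (circlepath 0 s) (\<lambda>u. k u / u * q u)"
    unfolding sums_def by (simp add: contour_integral_sum cf)
  from sums_divide[OF this, of "2 * of_real pi * \<i>"] show ?thesis
    by (simp only: fi times_divide_eq_left)
qed

text \<open>The point x = 0 is left out because the application has x = 1/w with w finite. Letting x
  tend to 0 gives \<open>a 0 = 0\<close>; division by x then shifts the series.\<close>

lemma power_series_eq_0_punctured:
  fixes a :: "nat \<Rightarrow> complex"
  assumes "0 < s" "\<And>x. x \<noteq> 0 \<Longrightarrow> norm x < s \<Longrightarrow> (\<lambda>n. a n * x ^ n) sums 0"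
  shows "a n = 0"
  using assms(2)
proof (induction n arbitrary: a)
  case 0
  have "((\<lambda>x::complex. 0) \<longlongrightarrow> a 0) (at 0)"
    by (rule powser_limit_0_strong[OF assms(1) 0])
  then show ?case by (metis tendsto_const LIM_unique)
next
  case (Suc n)
  have a0: "a 0 = 0"
  proof -
    have "((\<lambda>x::complex. 0) \<longlongrightarrow> a 0) (at 0)"
      by (rule powser_limit_0_strong[OF assms(1) Suc.prems])
    then show ?thesis by (metis tendsto_const LIM_unique)
  qed
  show ?case
  proof (rule Suc.IH[of "\<lambda>n. a (Suc n)"])
    fix x :: complex assume x: "x \<noteq> 0" "norm x < s"
    have "(\<lambda>n. a (Suc n) * x ^ Suc n) sums 0"
      using Suc.prems[OF x] a0 by (subst sums_Suc_iff) simp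
    from sums_divide[OF this, of x] show "(\<lambda>n. a (Suc n) * x ^ n) sums 0"
      using x by (simp add: field_simps)
  qed
qed


text \<open>Differentiating termwise and multiplying by x raises the exponent \<open>m\<close> by
  one.\<close>

lemma summable_powser_poly:
  fixes x :: real
  assumes "norm x < 1"
  shows "summable (\<lambda>n. real n ^ m * x ^ n)"
  using assms
proof (induction m arbitrary: x)
  case 0
  then show ?case by (simp add: summable_geometric)
next
  case (Suc m)
  have "summable (\<lambda>n. diffs (\<lambda>n. real n ^ m) n * x ^ n)"
    by (rule termdiff_converges[OF Suc.prems Suc.IH])
  from summable_mult[OF this, of x] have "summable (\<lambda>n. real (Suc n) ^ Suc m * x ^ Suc n)"
    by (simp add: diffs_def mult_ac)
  then show ?case by (subst (asm) summable_Suc_iff)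
qed

subsection \<open>The exterior map and the Faber polynomials\<close>

locale exterior_map =
  fixes G :: "complex set" and Psi :: "complex \<Rightarrow> complex" and c :: complex
  assumes Psi_holo: "Psi holomorphic_on {w. 1 < norm w}"
    and Psi_inj: "inj_on Psi {w. 1 < norm w}"
    and Psi_image: "Psi ` {w. 1 < norm w} = - G"
    and c_nonzero: "c \<noteq> 0"
    and Psi_lim: "((\<lambda>w. Psi w / w) \<longlongrightarrow> c) at_infinity"
begin

text \<open>\<open>Psi\<close> in the coordinate t = 1/w at infinity, times t to cancel the pole.
  The value \<open>c\<close> removes the singularity at 0.\<close>

definition chi :: "complex \<Rightarrow> complex" where
  "chi t = (if t = 0 then c else t * Psi (1 / t))"

text \<open>With t = 1/w this is w Psi'(w) / (Psi(w) - z), so its Taylor coefficients in t are the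
  Faber polynomials at z. It makes sense for z outside \<open>G\<close> as well, on a smaller
  disc.\<close>

definition faber_gen :: "complex \<Rightarrow> complex \<Rightarrow> complex" where
  "faber_gen z t = (chi t - t * deriv chi t) / (chi t - t * z)"

definition fcoef :: "complex \<Rightarrow> nat \<Rightarrow> complex" where
  "fcoef z n = (deriv ^^ n) (faber_gen z) 0 / fact n"

text \<open>The closed counterpart of \<open>GR\<close>: a compact set containing the closure of
  \<open>GR Psi G r\<close>, on which all uniform estimates are proved. For r = 1 it is
  \<open>G\<close>.\<close>

definition level_hull :: "real \<Rightarrow> complex set" where
  "level_hull r = G \<union> Psi ` {w. 1 < norm w \<and> norm w \<le> r}"

lemma open_exterior: "open {w::complex. r < norm w}"
  by (intro open_Collect_less continuous_intros)

lemma chi_holo: "chi holomorphic_on ball 0 1"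
proof (rule no_isolated_singularity'[where K = "{0}"])
  have "Psi \<circ> (\<lambda>t. 1 / t) holomorphic_on ball 0 1 - {0}"
    by (rule holomorphic_on_compose_gen[OF _ Psi_holo])
      (auto intro!: holomorphic_intros simp: norm_divide field_simps)
  then have "(\<lambda>t. t * Psi (1 / t)) holomorphic_on ball 0 1 - {0}"
    by (intro holomorphic_intros) (simp add: o_def)
  then show "chi holomorphic_on ball 0 1 - {0}"
    by (rule holomorphic_transform) (auto simp: chi_def)
  have "((\<lambda>t. Psi (inverse t) / inverse t) \<longlongrightarrow> c) (at 0)"
    using Psi_lim by (simp add: lim_at_infinity_0 o_def)
  then have "(chi \<longlongrightarrow> c) (at 0)"
    by (rule Lim_transform_eventually)
      (auto simp: chi_def eventually_at_filter field_simps intro!: always_eventually)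
  then have "(chi \<longlongrightarrow> chi 0) (at 0)"
    by (simp add: chi_def)
  then show "(chi \<longlongrightarrow> chi z) (at z within ball 0 1)" if "z \<in> {0}" for z
    using that by (auto intro: tendsto_within_subset)
qed auto

text \<open>At t = 0 the left side is \<open>c\<close>, which is nonzero. Elsewhere equality would
  mean \<open>Psi (1 / t) = z\<close> with |1/t| > r, against injectivity and the fact that
  \<open>Psi\<close> omits \<open>G\<close>. Hence \<open>faber_gen z\<close> has no pole in |t| <
  1/r.\<close>

lemma chi_nonzero:
  assumes "1 \<le> r" "z \<in> level_hull r" "norm t < 1 / r"
  shows "chi t \<noteq> t * z"
proof
  assume eq: "chi t = t * z"
  then have t: "t \<noteq> 0" using c_nonzero by (auto simp: chi_def)
  have n: "r < norm (1 / t)" using assms t by (simp add: norm_divide field_simps)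
  have z: "Psi (1 / t) = z" using eq t by (simp add: chi_def)
  show False using assms(2) unfolding level_hull_def
  proof
    assume "z \<in> G"
    then show False using Psi_image z n assms(1) by force
  next
    assume "z \<in> Psi ` {w. 1 < norm w \<and> norm w \<le> r}"
    then obtain w where "z = Psi w" "1 < norm w" "norm w \<le> r" by auto
    with z n assms(1) inj_onD[OF Psi_inj, of "1 / t" w] show False by auto
  qed
qed

lemma deriv_Psi_eq:
  assumes "1 < norm w"
  shows "deriv Psi w / (Psi w - z) = faber_gen z (1 / w) / w"
proof -
  have w: "w \<noteq> 0" using assms by auto
  have "1 / w \<in> ball 0 1" using assms w by (simp add: norm_divide divide_less_eq)
  then have "(chi has_field_derivative deriv chi (1 / w)) (at (1 / w))"
    using holomorphic_derivI[OF chi_holo open_ball] by blast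
  then have d: "((\<lambda>w. w * chi (1 / w)) has_field_derivative
      (chi (1 / w) - deriv chi (1 / w) / w)) (at w)"
    using w by (auto intro!: derivative_eq_intros DERIV_chain2[of chi] simp: field_simps)
  have ev: "\<forall>\<^sub>F v in nhds w. v * chi (1 / v) = Psi v"
    by (rule eventually_mono[OF eventually_nhds_in_open[OF open_exterior[of 1]]])
      (use assms in \<open>auto simp: chi_def\<close>)
  have "(Psi has_field_derivative (chi (1 / w) - deriv chi (1 / w) / w)) (at w)"
    by (rule iffD1[OF DERIV_cong_ev[OF refl ev refl] d])
  then have "deriv Psi w = chi (1 / w) - deriv chi (1 / w) / w"
    by (rule DERIV_imp_deriv)
  moreover have "Psi w = w * chi (1 / w)" using w by (simp add: chi_def)
  moreover have "(w * x - z) = w * (x - 1 / w * z)" for x using w by (simp add: field_simps)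
  ultimately show ?thesis using w unfolding faber_gen_def by simp
qed

lemma faber_gen_holo:
  assumes "1 \<le> r" "z \<in> level_hull r"
  shows "faber_gen z holomorphic_on ball 0 (1 / r)"
proof -
  have "ball 0 (1 / r) \<subseteq> ball 0 (1::real)" "ball (0::complex) (1 / r) \<subseteq> ball 0 1"
    using assms by (auto intro!: subset_ball simp: field_simps)
  then show ?thesis
    unfolding faber_gen_def using chi_nonzero[OF assms]
    by (intro holomorphic_intros holomorphic_on_subset[OF chi_holo]
          holomorphic_on_subset[OF holomorphic_deriv[OF chi_holo]]) auto
qed

lemma faber_gen_sums:
  assumes "1 \<le> r" "z \<in> level_hull r" "r < norm u"
  shows "(\<lambda>n. fcoef z n / u ^ n) sums faber_gen z (1 / u)"
proof -
  have "1 / norm u < 1 / r"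
    using assms by (intro divide_strict_left_mono mult_pos_pos) auto
  then have "1 / u \<in> ball 0 (1 / r)"
    by (simp add: norm_divide)
  from holomorphic_power_series[OF faber_gen_holo[OF assms(1,2)] this]
  show ?thesis by (simp add: fcoef_def power_divide)
qed

text \<open>As a formal power series \<open>faber_gen z\<close> is \<open>N / D z\<close>, where
  \<open>N\<close> is free of z and z enters \<open>D z\<close> only linearly, in the coefficient of
  index 1. The constant coefficient \<open>c\<close> of \<open>D z\<close> does not involve z
  either, so comparing coefficients in (N / D z) D z = N expresses each \<open>fcoef z n\<close>
  polynomially through z and the earlier ones.\<close>

lemma fcoef_polynomial: "\<exists>p. \<forall>z. poly p z = fcoef z n"
proof -
  have an: "chi analytic_on {0}"
    using chi_holo by (auto simp: analytic_at intro!: exI[of _ "ball 0 1"])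
  define X where "X = fps_expansion chi 0"
  have X: "chi has_fps_expansion X"
    unfolding X_def by (rule analytic_at_imp_has_fps_expansion_0[OF an])
  define N where "N = X - fps_X * fps_deriv X"
  have N: "(\<lambda>t. chi t - t * deriv chi t) has_fps_expansion N"
    unfolding N_def by (intro fps_expansion_intros X)
  define D where "D z = X - fps_X * fps_const z" for z
  have D: "(\<lambda>t. chi t - t * z) has_fps_expansion D z" for z
    unfolding D_def by (intro fps_expansion_intros X)
  have D0: "fps_nth (D z) 0 = c" for z
    using fps_nth_fps_expansion[OF D, of z 0] by (simp add: chi_def)
  have DS: "fps_nth (D z) m = poly [:fps_nth X m, - (if m = 1 then 1 else 0):] z" for z m
    by (simp add: D_def)
  have A: "fcoef z n = fps_nth (N / D z) n" for z n
  proof -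
    have "faber_gen z has_fps_expansion N / D z"
      unfolding faber_gen_def using has_fps_expansion_divide'[OF N D] D0 c_nonzero by simp
    from fps_nth_fps_expansion[OF this] show ?thesis by (simp add: fcoef_def)
  qed
  have rec: "fcoef z n = (fps_nth N n - (\<Sum>i<n. fcoef z i * fps_nth (D z) (n - i))) / c" for z n
  proof -
    have dvd: "D z dvd 1" using D0[of z] c_nonzero by (simp only: fps_is_unit_iff) simp
    have "N / D z * D z = N" by (rule dvd_div_mult_self[OF unit_imp_dvd[OF dvd]])
    then have "fps_nth N n = fps_nth (N / D z * D z) n" by (simp only:)
    also have "\<dots> = (\<Sum>i=0..n. fcoef z i * fps_nth (D z) (n - i))"
      by (simp only: A fps_mult_nth)
    also have "\<dots> = (\<Sum>i<n. fcoef z i * fps_nth (D z) (n - i)) + fcoef z n * c"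
      by (simp add: D0 atLeast0AtMost lessThan_Suc_atMost[symmetric])
    finally show ?thesis using c_nonzero by (simp add: field_simps)
  qed
  show ?thesis
  proof (induction n rule: less_induct)
    case (less n)
    then obtain P where P: "\<And>i z. i < n \<Longrightarrow> poly (P i) z = fcoef z i" by metis
    have "poly (smult (1 / c) ([:fps_nth N n:]
        - (\<Sum>i<n. P i * [:fps_nth X (n - i), - (if n - i = 1 then 1 else 0):]))) z = fcoef z n" for z
      unfolding rec[of z n] DS using P by (simp add: poly_sum del: mult_pCons_right mult_pCons_left)
    then show ?case by blast
  qed
qed

text \<open>\<open>faber_poly\<close> is an arbitrary choice, determined by its defining series only
  on \<open>G\<close>. The polynomials representing \<open>fcoef\<close> meet the same
  specification, so the choice exists and agrees with them on \<open>G\<close>; agreement at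
  infinitely many points extends to the whole plane.\<close>

lemma poly_faber_poly:
  assumes "infinite G"
  shows "poly (faber_poly G Psi n) z = fcoef z n"
proof -
  obtain P where P: "\<And>n z. poly (P n) z = fcoef z n" using fcoef_polynomial by metis
  let ?S = "\<lambda>P. \<forall>z\<in>G. \<forall>w. 1 < norm w \<longrightarrow>
       (\<lambda>n. poly (P n) z / w ^ Suc n) sums (deriv Psi w / (Psi w - z))"
  have "?S P"
  proof (intro ballI allI impI)
    fix z w assume "z \<in> G" and w: "1 < norm (w::complex)"
    then have "z \<in> level_hull 1" by (auto simp: level_hull_def)
    from sums_divide[OF faber_gen_sums[OF order_refl this w], of w]
    show "(\<lambda>n. poly (P n) z / w ^ Suc n) sums (deriv Psi w / (Psi w - z))"
      by (simp add: P deriv_Psi_eq[OF w] mult.commute)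
  qed
  then have F: "?S (faber_poly G Psi)"
    unfolding faber_poly_def by (rule someI[of ?S])
  have "poly (faber_poly G Psi n - P n) z = 0" if "z \<in> G" for z
    unfolding poly_diff
  proof (rule power_series_eq_0_punctured[where s = 1])
    fix x :: complex assume x: "x \<noteq> 0" "norm x < 1"
    then have w: "1 < norm (1 / x)" by (simp add: norm_divide)
    have "(\<lambda>n. poly (faber_poly G Psi n) z / (1 / x) ^ Suc n - poly (P n) z / (1 / x) ^ Suc n) sums 0"
      using sums_diff[OF F[rule_format, OF that w] \<open>?S P\<close>[rule_format, OF that w]] by simp
    moreover have "(a / (1 / x) ^ Suc n - b / (1 / x) ^ Suc n) / x = (a - b) * x ^ n" for a b n
      using x by (simp add: power_divide left_diff_distrib diff_divide_distrib)
    ultimately show "(\<lambda>n. (poly (faber_poly G Psi n) z - poly (P n) z) * x ^ n) sums 0"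
      using sums_divide[of _ 0 x] by fastforce
  qed simp
  then have "G \<subseteq> {z. poly (faber_poly G Psi n - P n) z = 0}" by auto
  then have "infinite {z. poly (faber_poly G Psi n - P n) z = 0}"
    using assms finite_subset by blast
  then have "faber_poly G Psi n - P n = 0" using poly_roots_finite by blast
  then show ?thesis by (simp add: P[symmetric])
qed

section \<open>Topology of the level sets\<close>

lemma GR_subset_level_hull: "GR Psi G r \<subseteq> level_hull r"
  by (auto simp: GR_def level_hull_def)

lemma level_hull_subset_GR: "r < R \<Longrightarrow> level_hull r \<subseteq> GR Psi G R"
  by (auto simp: GR_def level_hull_def)

lemma compl_level_hull:
  assumes "1 \<le> r"
  shows "- level_hull r = Psi ` {w. r < norm w}"
proof -
  have "{w. 1 < norm w} = {w. 1 < norm w \<and> norm w \<le> r} \<union> {w. r < norm (w::complex)}"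
    using assms by auto
  then have 1: "- G = Psi ` {w. 1 < norm w \<and> norm w \<le> r} \<union> Psi ` {w. r < norm w}"
    using Psi_image by (metis image_Un)
  have "Psi ` {w. 1 < norm w \<and> norm w \<le> r} \<inter> Psi ` {w. r < norm w} = {}"
    using inj_onD[OF Psi_inj] assms by fastforce
  then show ?thesis using 1 unfolding level_hull_def by blast
qed

lemma closed_level_hull:
  assumes "1 \<le> r"
  shows "closed (level_hull r)"
proof -
  have "open (Psi ` {w. r < norm w})"
    using assms by (intro open_mapping_thm3 open_exterior holomorphic_on_subset[OF Psi_holo]
        inj_on_subset[OF Psi_inj]) auto
  then show ?thesis using compl_level_hull[OF assms] by (simp add: closed_def)
qed

text \<open>By the open mapping theorem for \<open>t \<mapsto> 1 / \<Psi>(1/t)\<close> at the origin, \<open>\<Psi>\<close> maps \<open>|w| > r\<close> onto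
  a neighbourhood of infinity.\<close>
lemma bounded_level_hull:
  assumes "1 \<le> r"
  shows "bounded (level_hull r)"
proof -
  have "continuous (at 0) chi"
    using chi_holo by (auto simp: continuous_on_eq_continuous_at dest: holomorphic_on_imp_continuous_on)
  then obtain e where e: "0 < e" "\<And>t. norm t < e \<Longrightarrow> chi t \<noteq> 0"
    using continuous_at_avoid[of 0 chi 0] c_nonzero by (auto simp: chi_def dist_norm)
  \<comment> \<open>On |t| < d the function \<open>chi\<close> has no zeros, and
    \<open>chi_nonzero\<close> applies.\<close>
  define d where "d = min e (1 / r)"
  have d: "0 < d" "d \<le> e" "d \<le> 1 / r" "d \<le> 1"
    using e assms by (auto simp: d_def min_le_iff_disj)
  define \<phi> where "\<phi> t = t / chi t" for t
  have "\<phi> holomorphic_on ball 0 d"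
    unfolding \<phi>_def using d e by (intro holomorphic_intros holomorphic_on_subset[OF chi_holo]) auto
  \<comment> \<open>\<open>\<phi>\<close> vanishes at 0 and at no other point of the disc.\<close>
  moreover have "\<not> \<phi> constant_on ball 0 d"
  proof
    assume "\<phi> constant_on ball 0 d"
    then have "\<phi> (of_real (d / 2)) = \<phi> 0"
      using d unfolding constant_on_def by (metis centre_in_ball dist_0_norm
        mem_ball norm_of_real abs_of_pos half_gt_zero field_sum_of_halves less_add_same_cancel1)
    then show False using d e(2)[of "of_real (d / 2)"] by (simp add: \<phi>_def)
  qed
  ultimately have "open (\<phi> ` ball 0 d)"
    by (intro open_mapping_thm[of _ "ball 0 d"]) auto
  moreover have "0 \<in> \<phi> ` ball 0 d" using d by (auto simp: \<phi>_def intro!: image_eqI[of _ _ 0])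
  ultimately obtain \<delta> where \<delta>: "0 < \<delta>" "ball 0 \<delta> \<subseteq> \<phi> ` ball 0 d"
    using open_contains_ball by blast
  have "norm z \<le> 1 / \<delta>" if z: "z \<in> level_hull r" for z
  proof (rule ccontr)
    assume "\<not> norm z \<le> 1 / \<delta>"
    then have nz: "1 / \<delta> < norm z" by simp
    then have "z \<noteq> 0" using \<delta> by auto
    then have "1 / z \<in> ball 0 \<delta>" using nz \<delta> by (simp add: norm_divide field_simps)
    then obtain t where t: "norm t < d" "1 / z = t / chi t" using \<delta> by (auto simp: \<phi>_def)
    then have "chi t = t * z" using e(2)[of t] d \<open>z \<noteq> 0\<close> by (simp add: field_simps)
    then show False using chi_nonzero[OF assms z, of t] t d by simp
  qed
  then show ?thesis by (auto simp: bounded_iff)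
qed

lemma compact_level_hull: "1 \<le> r \<Longrightarrow> compact (level_hull r)"
  using bounded_level_hull closed_level_hull compact_eq_bounded_closed by blast

lemma closure_GR: "1 \<le> r \<Longrightarrow> closure (GR Psi G r) \<subseteq> level_hull r"
  using closed_level_hull GR_subset_level_hull by (simp add: closure_minimal)

text \<open>Boundary points of \<open>G\<close> are the delicate ones. Membership of z is equivalent
  to \<open>chi t - t * z\<close> having no zero on the compact disc |t| \<le> 1/R. Its minimum
  modulus there is then some positive \<open>\<epsilon>\<close>, and moving z by less than
  \<open>\<epsilon>\<close> changes the value by less than \<open>\<epsilon>\<close> because |t|
  \<le> 1.\<close>

lemma open_GR:
  assumes "1 < R"
  shows "open (GR Psi G R)"
proof -
  have eq: "z \<in> GR Psi G R \<longleftrightarrow> (\<forall>t\<in>cball 0 (1 / R). chi t - t * z \<noteq> 0)" for z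
  proof
    assume z: "z \<in> GR Psi G R"
    then obtain r where r: "1 \<le> r" "r < R" "z \<in> level_hull r"
    proof -
      consider "z \<in> G" | w where "z = Psi w" "1 < norm w" "norm w < R"
        using z by (auto simp: GR_def)
      then show ?thesis
      proof cases
        case 1
        then show ?thesis using that[of 1] assms by (simp add: level_hull_def)
      next
        case (2 w)
        then show ?thesis using that[of "norm w"] by (auto simp: level_hull_def)
      qed
    qed
    then have "1 / R < 1 / r" using assms by (simp add: field_simps)
    then show "\<forall>t\<in>cball 0 (1 / R). chi t - t * z \<noteq> 0"
      using chi_nonzero[OF r(1,3)] by fastforce
  next
    assume a: "\<forall>t\<in>cball 0 (1 / R). chi t - t * z \<noteq> 0"
    show "z \<in> GR Psi G R"
    proof (rule ccontr)
      assume nz: "z \<notin> GR Psi G R"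
      then have "z \<in> - G" by (auto simp: GR_def)
      then obtain w where w: "z = Psi w" "1 < norm w" using Psi_image by blast
      then have "R \<le> norm w" using nz by (force simp: GR_def)
      then have "1 / w \<in> cball 0 (1 / R)" "w \<noteq> 0"
        using assms by (auto simp: norm_divide frac_le)
      then show False using bspec[OF a, of "1 / w"] w by (simp add: chi_def)
    qed
  qed
  show ?thesis unfolding open_contains_ball
  proof
    fix z assume z: "z \<in> GR Psi G R"
    have "cball (0::complex) (1 / R) \<subseteq> ball 0 1"
      using assms by (simp add: cball_subset_ball_iff)
    then have "continuous_on (cball 0 (1 / R)) (\<lambda>t. norm (chi t - t * z))"
      by (intro continuous_intros holomorphic_on_imp_continuous_on
          holomorphic_on_subset[OF chi_holo])
    then obtain t0 where t0: "t0 \<in> cball 0 (1 / R)"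
      "\<And>t. t \<in> cball 0 (1 / R) \<Longrightarrow> norm (chi t0 - t0 * z) \<le> norm (chi t - t * z)"
      using continuous_attains_inf[of "cball 0 (1 / R)" "\<lambda>t. norm (chi t - t * z)"] assms by auto
    define \<epsilon> where "\<epsilon> = norm (chi t0 - t0 * z)"
    have "0 < \<epsilon>" using z t0 eq unfolding \<epsilon>_def by auto
    have "ball z \<epsilon> \<subseteq> GR Psi G R"
    proof
      fix y assume y: "y \<in> ball z \<epsilon>"
      show "y \<in> GR Psi G R" unfolding eq
      proof (intro ballI notI)
        fix t assume t: "t \<in> cball (0::complex) (1 / R)" and 0: "chi t - t * y = 0"
        have "norm t \<le> 1" using t assms by (auto intro: order_trans[of _ "1 / R"])
        have "\<epsilon> \<le> norm (chi t - t * z)" using t0 t unfolding \<epsilon>_def by blast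
        also have "chi t - t * z = t * (y - z)" using 0 by (simp add: algebra_simps)
        also have "norm \<dots> \<le> 1 * norm (y - z)"
          unfolding norm_mult using \<open>norm t \<le> 1\<close> by (intro mult_right_mono) auto
        finally show False using y by (simp add: dist_norm norm_minus_commute)
      qed
    qed
    then show "\<exists>e>0. ball z e \<subseteq> GR Psi G R" using \<open>0 < \<epsilon>\<close> by blast
  qed
qed

subsection \<open>Faber coefficients and the associated function\<close>

lemma compose_Psi_holo:
  assumes "h holomorphic_on GR Psi G R"
  shows "(\<lambda>u. h (Psi u)) holomorphic_on {w. 1 < norm w \<and> norm w < R}"
proof -
  have "h \<circ> Psi holomorphic_on {w. 1 < norm w \<and> norm w < R}"
    by (rule holomorphic_on_compose_gen[OF _ assms])
      (auto intro: holomorphic_on_subset[OF Psi_holo] simp: GR_def)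
  then show ?thesis by (simp add: o_def)
qed

lemma faber_coeff_eq:
  assumes "h holomorphic_on GR Psi G R" "1 < s" "s < R"
  shows "faber_coeff Psi h n
    = contour_integral (circlepath 0 s) (\<lambda>u. h (Psi u) / u ^ Suc n) / (2 * of_real pi * \<i>)"
  unfolding faber_coeff_def
  by (rule Lim_circlepath_integral[where R = R])
    (use assms in \<open>auto intro!: holomorphic_intros compose_Psi_holo\<close>)

lemma assoc_H_eq:
  assumes "h holomorphic_on GR Psi G R" "1 < s" "s < R" "norm w < 1"
  shows "assoc_H Psi h w
    = contour_integral (circlepath 0 s) (\<lambda>u. h (Psi u) / (u - w)) / (2 * of_real pi * \<i>)"
  unfolding assoc_H_def
  by (rule Lim_circlepath_integral[where R = R])
    (use assms in \<open>auto intro!: holomorphic_intros compose_Psi_holo\<close>)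

lemma continuous_compose_Psi:
  assumes "h holomorphic_on GR Psi G R" "1 < s" "s < R"
  shows "continuous_on (sphere 0 s) (\<lambda>u. h (Psi u))"
  using assms by (intro continuous_on_subset[OF holomorphic_on_imp_continuous_on[OF compose_Psi_holo[OF assms(1)]]]) auto

lemma faber_coeff_bound:
  assumes h: "h holomorphic_on GR Psi G R" and s: "1 < s" "s < R"
  obtains A where "0 \<le> A" "\<And>n. norm (faber_coeff Psi h n) \<le> A / s ^ n"
proof -
  note k = continuous_compose_Psi[OF assms]
  obtain M where "\<forall>u\<in>sphere 0 s. norm (h (Psi u)) \<le> M"
    using compact_imp_bounded[OF compact_continuous_image[OF k compact_sphere]]
    by (auto simp: bounded_iff)
  then have M: "norm (h (Psi u)) \<le> M" if "norm u = s" for u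
    using that by simp
  have M0: "0 \<le> M" using order_trans[OF norm_ge_zero M[of "of_real s"]] s by simp
  have "norm (faber_coeff Psi h n) \<le> M / s ^ n" for n
  proof -
    let ?f = "\<lambda>u. h (Psi u) / u ^ Suc n"
    have "?f contour_integrable_on circlepath 0 s"
      using s by (intro contour_integrable_continuous_circlepath continuous_intros)
        (auto intro: continuous_on_subset[OF k])
    then have "norm (contour_integral (circlepath 0 s) ?f) \<le> M / s ^ Suc n * (2 * pi * s)"
      using M M0 s
      by (intro has_contour_integral_bound_circlepath[OF has_contour_integral_integral])
        (auto simp: norm_divide norm_mult norm_power intro!: divide_right_mono)
    then show ?thesis
      using s by (simp add: faber_coeff_eq[OF assms] norm_divide norm_mult field_simps)
  qed
  then show ?thesis using that M0 by blast
qed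

lemma faber_coeff_summable:
  assumes "h holomorphic_on GR Psi G R" "1 < R" "norm x < R"
  shows "summable (\<lambda>n. faber_coeff Psi h n * x ^ n)"
proof -
  obtain s where s: "max 1 (norm x) < s" "s < R" using assms dense[of "max 1 (norm x)" R] by auto
  then obtain A where A: "0 \<le> A" "\<And>n. norm (faber_coeff Psi h n) \<le> A / s ^ n"
    using faber_coeff_bound[OF assms(1), of s] by auto
  show ?thesis
  proof (rule summable_comparison_test')
    show "summable (\<lambda>n. A * (norm x / s) ^ n)"
      using s by (intro summable_mult summable_geometric) auto
    show "norm (faber_coeff Psi h n * x ^ n) \<le> A * (norm x / s) ^ n" for n
      using mult_right_mono[OF A(2)[of n], of "norm x ^ n"]
      by (simp add: norm_mult norm_power power_divide)
  qed
qed

text \<open>Inside the unit disc, expand 1/(u - w) geometrically on |u| = s. The resulting power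
  series converges for |w| < R with R > 1, so it is continuous across the unit circle and its value
  there is the limit that defines \<open>assoc_ext\<close>.\<close>

lemma assoc_ext_sums:
  assumes h: "h holomorphic_on GR Psi G R" and R: "1 < R" and w: "norm w \<le> 1"
  shows "(\<lambda>n. faber_coeff Psi h n * w ^ n) sums assoc_ext Psi h w"
proof -
  obtain s where s: "1 < s" "s < R" using R dense by blast
  define S where "S w = (\<Sum>n. faber_coeff Psi h n * w ^ n)" for w
  have inner: "assoc_H Psi h w = S w" if w: "norm w < 1" for w
  proof -
    have "(\<lambda>n. contour_integral (circlepath 0 s) (\<lambda>u. h (Psi u) / u ^ Suc n) / (2 * of_real pi * \<i>) * w ^ n)
      sums (contour_integral (circlepath 0 s) (\<lambda>u. h (Psi u) / u * (1 / (1 - w / u))) / (2 * of_real pi * \<i>))"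
    proof (rule circlepath_integral_sums)
      show "summable (\<lambda>n. norm (w ^ n) / s ^ n)"
        using s w by (simp add: norm_power power_divide[symmetric] summable_geometric)
      fix u :: complex assume u: "norm u = s"
      then have "norm (w / u) < 1" using s w by (simp add: norm_divide)
      from geometric_sums[OF this] show "(\<lambda>n. w ^ n / u ^ n) sums (1 / (1 - w / u))"
        by (simp add: power_divide)
    qed (use s continuous_compose_Psi[OF h s] in auto)
    also have "contour_integral (circlepath 0 s) (\<lambda>u. h (Psi u) / u * (1 / (1 - w / u)))
        = contour_integral (circlepath 0 s) (\<lambda>u. h (Psi u) / (u - w))"
    proof (rule contour_integral_cong[OF refl])
      fix u assume "u \<in> path_image (circlepath 0 s)"
      then have "norm u = s" using s by simp
      then have "u \<noteq> 0" "u \<noteq> w" using s w by auto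
      then show "h (Psi u) / u * (1 / (1 - w / u)) = h (Psi u) / (u - w)"
        by (simp add: field_simps)
    qed
    finally show ?thesis
      unfolding faber_coeff_eq[OF h s, symmetric] assoc_H_eq[OF h s w, symmetric]
      by (simp add: S_def sums_iff)
  qed
  have "assoc_ext Psi h w = S w"
  proof (cases "norm w < 1")
    case False
    have "isCont S w"
      unfolding S_def
      by (rule isCont_powser[OF faber_coeff_summable[OF h R, of "of_real s"]]) (use s w in auto)
    then have "(S \<longlongrightarrow> S w) (at w within ball 0 1)"
      by (simp add: continuous_at_imp_continuous_at_within continuous_within[symmetric])
    then have "(assoc_H Psi h \<longlongrightarrow> S w) (at w within ball 0 1)"
      by (rule Lim_transform_eventually) (auto simp: eventually_at_filter inner)
    moreover have "at w within ball 0 1 \<noteq> bot"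
      using w by (simp add: trivial_limit_within islimpt_ball)
    ultimately show ?thesis
      using False by (simp add: assoc_ext_def tendsto_Lim)
  qed (simp add: assoc_ext_def inner)
  moreover have "(\<lambda>n. faber_coeff Psi h n * w ^ n) sums S w"
    unfolding S_def using w R by (intro summable_sums faber_coeff_summable[OF h R]) auto
  ultimately show ?thesis by simp
qed

text \<open>Cauchy's inequality on |t| = 1/s, a circle inside the disc |t| < 1/r where
  \<open>faber_gen z\<close> is holomorphic. One \<open>M\<close> serves all z because
  \<open>level_hull r\<close> times the circle is compact and the denominator has no zero on
  it.\<close>

lemma fcoef_bound:
  assumes "1 \<le> r" "r < s"
  obtains M where "0 \<le> M" "\<And>z n. z \<in> level_hull r \<Longrightarrow> norm (fcoef z n) \<le> M * s ^ n"
proof -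
  have le: "1 / s < 1 / r" using assms by (simp add: frac_less2)
  have ne: "chi t - t * z \<noteq> 0" if "z \<in> level_hull r" "norm t \<le> 1 / s" for z t
    using chi_nonzero[OF assms(1) that(1), of t] that(2) le by auto
  let ?K = "level_hull r \<times> sphere (0::complex) (1 / s)"
  have lt: "1 / s < 1"
    using assms by simp
  have c: "continuous_on ?K (\<lambda>x. chi (snd x))" "continuous_on ?K (\<lambda>x. deriv chi (snd x))"
    using lt by (auto intro!: continuous_on_compose2[OF holomorphic_on_imp_continuous_on continuous_on_snd[OF continuous_on_id]]
        chi_holo holomorphic_deriv)
  have "continuous_on ?K (\<lambda>x. faber_gen (fst x) (snd x))"
    unfolding faber_gen_def by (intro continuous_intros c) (use ne in force)
  moreover have "compact ?K" using compact_level_hull[OF assms(1)] by (intro compact_Times) auto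
  ultimately have "bounded ((\<lambda>x. faber_gen (fst x) (snd x)) ` ?K)"
    by (intro compact_imp_bounded compact_continuous_image)
  then obtain M where M: "\<forall>x\<in>?K. norm (faber_gen (fst x) (snd x)) \<le> M"
    unfolding bounded_iff by auto
  have "norm (fcoef z n) \<le> \<bar>M\<bar> * s ^ n" if z: "z \<in> level_hull r" for z n
  proof -
    have "norm ((deriv ^^ n) (faber_gen z) 0) \<le> fact n * \<bar>M\<bar> / (1 / s) ^ n"
    proof (rule Cauchy_inequality)
      have "cball 0 (1 / s) \<subseteq> ball 0 (1 / r)" "ball 0 (1 / s) \<subseteq> ball (0::complex) (1 / r)"
        using le by auto
      with faber_gen_holo[OF assms(1) z]
      show "faber_gen z holomorphic_on ball 0 (1 / s)" "continuous_on (cball 0 (1 / s)) (faber_gen z)"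
        by (auto intro: holomorphic_on_subset holomorphic_on_imp_continuous_on continuous_on_subset)
      show "norm (faber_gen z x) \<le> \<bar>M\<bar>" if "norm (0 - x) = 1 / s" for x
        using bspec[OF M, of "(z, x)"] z that by auto
    qed (use assms in auto)
    then show ?thesis
      by (simp add: fcoef_def norm_divide field_simps)
  qed
  then show ?thesis using that[of "\<bar>M\<bar>"] by auto
qed

section \<open>Cauchy's formula on level curves and the Faber expansion\<close>

text \<open>The complement of \<open>level_hull s\<close> is the \<open>Psi\<close>-image of the
  connected set |v| > s, is unbounded and misses the curve, so it lies in an unbounded component of
  the curve's complement.\<close>

lemma winding_number_level_curve_outside:
  assumes s: "1 < s" and w: "w \<notin> level_hull s"
  shows "winding_number (Psi \<circ> circlepath 0 s) w = 0"
proof (rule winding_number_zero_in_outside)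
  let ?S = "path_image (Psi \<circ> circlepath 0 s)"
  have pim: "?S = Psi ` sphere 0 s" using s by (simp add: path_image_compose)
  show "path (Psi \<circ> circlepath 0 s)"
    using s by (intro path_continuous_image continuous_on_subset[OF holomorphic_on_imp_continuous_on[OF Psi_holo]]) auto
  show "pathfinish (Psi \<circ> circlepath 0 s) = pathstart (Psi \<circ> circlepath 0 s)"
    by (simp add: pathfinish_compose pathstart_compose)
  have "{v. s < norm v} = - cball (0::complex) s" by auto
  then have "connected {v::complex. s < norm v}"
    using connected_complement_bounded_convex[of "cball (0::complex) s"] by simp
  then have "connected (- level_hull s)"
    unfolding compl_level_hull[OF less_imp_le[OF s]] using s
    by (intro connected_continuous_image continuous_on_subset[OF holomorphic_on_imp_continuous_on[OF Psi_holo]]) auto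
  moreover have "- level_hull s \<subseteq> - ?S"
    using s by (auto simp: pim level_hull_def)
  ultimately have "- level_hull s \<subseteq> connected_component_set (- ?S) w"
    using w by (intro connected_component_maximal) auto
  moreover have "\<not> bounded (- level_hull s)"
    using bounded_level_hull[OF less_imp_le[OF s]] cobounded_imp_unbounded[of "- level_hull s"] by auto
  ultimately show "w \<in> outside ?S"
    using bounded_subset by (auto simp: outside)
qed

text \<open>The defining series of the Faber polynomials, integrated against \<open>h \<circ> \<Psi>\<close> over \<open>|u| = s\<close>, is
  the Cauchy integral of \<open>h\<close> over the level curve; the case \<open>h = 1\<close> yields its winding number.\<close>
lemma faber_expansion:
  assumes h: "h holomorphic_on GR Psi G R" and r: "1 \<le> r" "r < R" and z: "z \<in> level_hull r"
  shows "(\<lambda>n. faber_coeff Psi h n * fcoef z n) sums h z"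
proof -
  obtain s where s: "r < s" "s < R" using r dense by blast
  have s1: "1 < s" "1 < R" using s r by auto
  let ?c = "circlepath 0 s"
  define \<gamma> where "\<gamma> = Psi \<circ> ?c"
  have vp: "valid_path \<gamma>" unfolding \<gamma>_def
    using s1 by (intro valid_path_compose_holomorphic[OF _ Psi_holo open_exterior]) auto
  have pim: "path_image \<gamma> = Psi ` sphere 0 s"
    using s1 by (simp add: \<gamma>_def path_image_compose)
  have znot: "z \<notin> path_image \<gamma>"
  proof -
    have "Psi ` sphere 0 s \<subseteq> - level_hull r"
      unfolding compl_level_hull[OF r(1)] using s by auto
    then show ?thesis using z pim by auto
  qed
  obtain s' where s': "r < s'" "s' < s" using s dense by blast
  \<comment> \<open>Convergence at the smaller radius \<open>s'\<close> > r upgrades to absolute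
    convergence at \<open>s\<close>.\<close>
  have smc: "summable (\<lambda>n. norm (fcoef z n) / s ^ n)"
  proof -
    have "summable (\<lambda>n. fcoef z n * (1 / of_real s') ^ n)"
      using faber_gen_sums[OF r(1) z, of "of_real s'"] s' r
      by (auto simp: sums_iff power_divide)
    then have "summable (\<lambda>n. norm (fcoef z n * (1 / of_real s) ^ n))"
      by (rule powser_insidea) (use s s' r in \<open>auto simp: norm_divide frac_less2\<close>)
    then show ?thesis using s r by (simp add: norm_mult norm_power norm_divide power_divide)
  qed
  have cauchy: "(\<lambda>n. contour_integral ?c (\<lambda>u. k (Psi u) / u ^ Suc n) / (2 * of_real pi * \<i>) * fcoef z n)
      sums (contour_integral \<gamma> (\<lambda>w. k w / (w - z)) / (2 * of_real pi * \<i>))"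
    if k: "continuous_on (sphere 0 s) (\<lambda>u. k (Psi u))" for k
  proof -
    have "(\<lambda>n. contour_integral ?c (\<lambda>u. k (Psi u) / u ^ Suc n) / (2 * of_real pi * \<i>) * fcoef z n)
      sums (contour_integral ?c (\<lambda>u. k (Psi u) / u * faber_gen z (1 / u)) / (2 * of_real pi * \<i>))"
      by (rule circlepath_integral_sums[OF _ k smc faber_gen_sums[OF r(1) z]]) (use s s1 in auto)
    also have "contour_integral ?c (\<lambda>u. k (Psi u) / u * faber_gen z (1 / u))
       = contour_integral ?c (\<lambda>u. deriv Psi u * (k (Psi u) / (Psi u - z)))"
    proof (rule contour_integral_cong[OF refl])
      fix u assume "u \<in> path_image ?c"
      then have u: "1 < norm u" using s1 by simp
      have "k (Psi u) / u * faber_gen z (1 / u) = k (Psi u) * (faber_gen z (1 / u) / u)"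
        by simp
      also note deriv_Psi_eq[OF u, symmetric]
      finally show "k (Psi u) / u * faber_gen z (1 / u) = deriv Psi u * (k (Psi u) / (Psi u - z))"
        by simp
    qed
    \<comment> \<open>The substitution w = Psi(u).\<close>
    also have "\<dots> = contour_integral \<gamma> (\<lambda>w. k w / (w - z))"
      unfolding \<gamma>_def
      by (rule contour_integral_comp_analyticW[where s = "{w. 1 < norm w}", symmetric])
        (use s1 Psi_holo open_exterior in \<open>auto simp: analytic_on_open\<close>)
    finally show ?thesis .
  qed
  have "winding_number \<gamma> z = 1"
  proof -
    have I: "contour_integral ?c (\<lambda>u. 1 / u ^ Suc n) / (2 * of_real pi * \<i>) = (if n = 0 then 1 else 0)" for n
    proof -
      have "((\<lambda>u. 1 / (u - 0) ^ Suc n) has_contour_integral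
          ((2 * pi * \<i>) / fact n * (deriv ^^ n) (\<lambda>_. 1) 0)) ?c"
        by (rule Cauchy_has_contour_integral_higher_derivative_circlepath) (use s1 in auto)
      from contour_integral_unique[OF this] show ?thesis by simp
    qed
    \<comment> \<open>Only n = 0 survives the integration, and \<open>faber_gen z 0\<close> is c/c,
      so the winding number is 1.\<close>
    have "fcoef z 0 = 1" using c_nonzero by (simp add: fcoef_def faber_gen_def chi_def)
    then have "(\<lambda>n. contour_integral ?c (\<lambda>u. 1 / u ^ Suc n) / (2 * of_real pi * \<i>) * fcoef z n)
        = (\<lambda>n. if n = 0 then 1 else 0)"
      unfolding I by auto
    moreover have "(\<lambda>n. if n = 0 then 1 else 0 :: complex) sums 1"
      using sums_single[of 0 "\<lambda>_. 1 :: complex"] by simp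
    ultimately have "contour_integral \<gamma> (\<lambda>w. 1 / (w - z)) / (2 * of_real pi * \<i>) = 1"
      using cauchy[of "\<lambda>_. 1"] sums_unique2 by fastforce
    then show ?thesis by (simp add: winding_number_valid_path[OF vp znot])
  qed
  moreover have "((\<lambda>w. h w / (w - z)) has_contour_integral (2 * pi * \<i> * winding_number \<gamma> z * h z)) \<gamma>"
  proof (rule Cauchy_integral_formula_global[OF open_GR[OF s1(2)] h _ vp])
    show "z \<in> GR Psi G R" using z level_hull_subset_GR[OF r(2)] by auto
    have "path_image \<gamma> \<subseteq> GR Psi G R"
      using s s1 by (auto simp: pim GR_def)
    then show "path_image \<gamma> \<subseteq> GR Psi G R - {z}" using znot by auto
    show "pathfinish \<gamma> = pathstart \<gamma>"
      by (simp add: \<gamma>_def pathfinish_compose pathstart_compose)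
    show "winding_number \<gamma> w = 0" if "w \<notin> GR Psi G R" for w
      unfolding \<gamma>_def using that level_hull_subset_GR[OF s(2)]
      by (intro winding_number_level_curve_outside[OF s1(1)]) auto
  qed
  ultimately have "contour_integral \<gamma> (\<lambda>w. h w / (w - z)) / (2 * of_real pi * \<i>) = h z"
    by (simp add: contour_integral_unique)
  then show ?thesis
    using cauchy[OF continuous_compose_Psi[OF h s1(1) s(2)]] faber_coeff_eq[OF h s1(1) s(2)] by simp
qed

subsection \<open>The asymptotic expansion of the Bernstein-Faber polynomials\<close>

text \<open>The terms of the coefficient of 1/n in the expansion of \<open>bernstein_faber\<close>;
  k(k-1)/2 is the number of pairs of balls that can collide. They vanish for k = 0 and k =
  1.\<close>

definition voronovskaja_term :: "(complex \<Rightarrow> complex) \<Rightarrow> complex \<Rightarrow> nat \<Rightarrow> complex" where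
  "voronovskaja_term h z k = of_real (real k * (real k - 1) / 2) * (fcoef z (k - 1) - fcoef z k) * faber_coeff Psi h k"

text \<open>The difference of order p \<le> n evaluates the function only at nodes j/n in [0,1],
  where its power series converges, so it may be taken termwise; on monomials it yields
  \<open>occupancy\<close>.\<close>

lemma bernstein_faber_sums:
  assumes G: "infinite G" and h: "h holomorphic_on GR Psi G R" and R: "1 < R" and n: "0 < n"
  shows "(\<lambda>k. faber_coeff Psi h k * (\<Sum>p\<le>k. of_real (occupancy n k p) * fcoef z p))
    sums bernstein_faber G Psi h n z"
proof -
  have fd: "(\<lambda>k. faber_coeff Psi h k * fwd_diff (\<lambda>x. x ^ k) (1 / real n) p)
      sums fwd_diff (assoc_ext Psi h) (1 / real n) p" if "p \<le> n" for p
  proof -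
    have "(\<lambda>k. \<Sum>j=0..p. (-1) ^ (p - j) * of_nat (p choose j)
          * (faber_coeff Psi h k * of_real (real j * (1 / real n)) ^ k))
      sums (\<Sum>j=0..p. (-1) ^ (p - j) * of_nat (p choose j) * assoc_ext Psi h (of_real (real j * (1 / real n))))"
    proof (intro sums_sum sums_mult assoc_ext_sums[OF h R])
      fix j assume "j \<in> {0..p}"
      then have "\<bar>real j * (1 / real n)\<bar> \<le> 1" using that n by simp
      then show "norm (of_real (real j * (1 / real n)) :: complex) \<le> 1" unfolding norm_of_real .
    qed
    then show ?thesis by (simp add: fwd_diff_def sum_distrib_left mult_ac)
  qed
  have "(\<lambda>k. \<Sum>p=0..n. of_nat (n choose p)
        * (faber_coeff Psi h k * fwd_diff (\<lambda>x. x ^ k) (1 / real n) p) * fcoef z p)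
      sums (\<Sum>p=0..n. of_nat (n choose p) * fwd_diff (assoc_ext Psi h) (1 / real n) p * fcoef z p)"
    by (intro sums_sum sums_mult sums_mult2 fd) auto
  moreover have "(\<Sum>p=0..n. of_nat (n choose p)
        * (faber_coeff Psi h k * fwd_diff (\<lambda>x. x ^ k) (1 / real n) p) * fcoef z p)
      = faber_coeff Psi h k * (\<Sum>p\<le>k. of_real (occupancy n k p) * fcoef z p)" for k
  proof -
    have "(\<Sum>p=0..n. of_nat (n choose p)
        * (faber_coeff Psi h k * fwd_diff (\<lambda>x. x ^ k) (1 / real n) p) * fcoef z p)
      = faber_coeff Psi h k * (\<Sum>p=0..n. of_real (occupancy n k p) * fcoef z p)"
      unfolding sum_distrib_left
      by (intro sum.cong refl) (simp add: binomial_fwd_diff_power[OF n, symmetric] mult_ac)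
    \<comment> \<open>The range is enlarged to \<open>max n k\<close> and then cut to
      \<open>k\<close>: \<open>occupancy\<close> vanishes beyond \<open>n\<close> as well as beyond
      \<open>k\<close>.\<close>
    also have "(\<Sum>p=0..n. of_real (occupancy n k p) * fcoef z p)
        = (\<Sum>p\<le>max n k. of_real (occupancy n k p) * fcoef z p)"
      using occupancy_eq_0'[OF n] by (intro sum.mono_neutral_left) auto
    also have "\<dots> = (\<Sum>p\<le>k. of_real (occupancy n k p) * fcoef z p)"
      using occupancy_eq_0[of k _ n] by (intro sum.mono_neutral_right) auto
    finally show ?thesis .
  qed
  ultimately show ?thesis
    by (simp add: bernstein_faber_def poly_faber_poly[OF G])
qed

text \<open>With radii r < s < s' < R, the Faber polynomials grow at most like s^k on the hull and
  the coefficients decay like s'^(-k). The ratio q = s/s' < 1 therefore outweighs the factor k^4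
  from \<open>occupancy_expectation\<close>.\<close>

lemma bernstein_faber_expansion:
  assumes G: "infinite G" and h: "h holomorphic_on GR Psi G R" and r: "1 < r" "r < R"
  obtains C L where "0 \<le> C"
    "\<And>z. z \<in> level_hull r \<Longrightarrow> voronovskaja_term h z sums L z"
    "\<And>z. z \<in> level_hull r \<Longrightarrow> norm (L z) \<le> C"
    "\<And>n z. 0 < n \<Longrightarrow> z \<in> level_hull r \<Longrightarrow>
       norm (bernstein_faber G Psi h n z - h z - L z / of_nat n) \<le> C / real n ^ 2"
proof -
  obtain s where s: "r < s" "s < R" using r dense by blast
  obtain s' where s': "s < s'" "s' < R" using s dense by blast
  have gt1: "1 < s" "1 < s'" "1 < R" using r s s' by auto
  obtain A where A: "0 \<le> A" "\<And>k. norm (faber_coeff Psi h k) \<le> A / s' ^ k"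
    using faber_coeff_bound[OF h gt1(2) s'(2)] by blast
  obtain M where M: "0 \<le> M" "\<And>z k. z \<in> level_hull r \<Longrightarrow> norm (fcoef z k) \<le> M * s ^ k"
    using fcoef_bound[OF less_imp_le[OF r(1)] s(1)] by blast
  define q where "q = s / s'"
  have q: "0 < q" "q < 1" using gt1 s' by (auto simp: q_def)
  \<comment> \<open>\<open>occupancy_expectation\<close> needs one bound for all indices p \<le> k;
    since s > 1, the bound at \<open>k\<close> serves.\<close>
  have M': "norm (fcoef z p) \<le> M * s ^ k" if "z \<in> level_hull r" "p \<le> k" for z p k
    using M(2)[OF that(1), of p] mult_left_mono[OF power_increasing[OF that(2), of s] M(1)] gt1
    by linarith
  \<comment> \<open>The factor 4 is that of \<open>occupancy_expectation\<close>. The same majorant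
    dominates the Voronovskaja terms, since k(k-1)/2 \<le> k^4, so one constant serves both
    estimates.\<close>
  define C where "C = (\<Sum>k. 4 * A * M * (real k ^ 4 * q ^ k))"
  have sm: "summable (\<lambda>k. 4 * A * M * (real k ^ 4 * q ^ k))"
    using q by (intro summable_mult summable_powser_poly) auto
  have C0: "0 \<le> C" unfolding C_def using A M q by (intro suminf_nonneg sm) auto
  have tb: "norm (voronovskaja_term h z k) \<le> 4 * A * M * (real k ^ 4 * q ^ k)"
    if z: "z \<in> level_hull r" for z k
  proof -
    have k4: "\<bar>real k * (real k - 1) / 2\<bar> \<le> real k ^ 4"
    proof (cases k)
      case (Suc m)
      have "\<bar>real k * (real k - 1) / 2\<bar> = real k * real m / 2" by (simp add: Suc)
      also have "\<dots> \<le> real k * real k" using Suc by (simp add: field_simps)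
      also have "\<dots> \<le> real k ^ 4" using power_increasing[of 2 4 "real k"] Suc by (simp add: power2_eq_square)
      finally show ?thesis .
    qed simp
    have "norm (fcoef z (k - 1) - fcoef z k) \<le> 2 * (M * s ^ k)"
      using norm_triangle_ineq4[of "fcoef z (k - 1)" "fcoef z k"] M'[OF z, of "k - 1" k] M'[OF z, of k k]
      by linarith
    then have "norm (voronovskaja_term h z k) \<le> real k ^ 4 * (2 * (M * s ^ k)) * (A / s' ^ k)"
      unfolding voronovskaja_term_def norm_mult norm_of_real using k4 A M gt1
      by (intro mult_mono) auto
    also have "\<dots> = 2 * (A * M) * (real k ^ 4 * q ^ k)"
      by (simp add: q_def power_divide)
    also have "\<dots> \<le> 4 * A * M * (real k ^ 4 * q ^ k)"
      unfolding mult.assoc using A M q by (intro mult_right_mono) auto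
    finally show ?thesis .
  qed
  define L where "L z = (\<Sum>k. voronovskaja_term h z k)" for z
  have Ls: "voronovskaja_term h z sums L z" if "z \<in> level_hull r" for z
    unfolding L_def by (intro summable_sums summable_comparison_test'[OF sm]) (rule tb[OF that])
  have Lb: "norm (L z) \<le> C" if "z \<in> level_hull r" for z
    unfolding L_def C_def by (intro norm_suminf_le sm tb that)
  have "norm (bernstein_faber G Psi h n z - h z - L z / of_nat n) \<le> C / real n ^ 2"
    if n: "0 < n" and z: "z \<in> level_hull r" for n z
  proof -
    let ?e = "\<lambda>k. (\<Sum>p\<le>k. of_real (occupancy n k p) * fcoef z p) - fcoef z k
      - of_real (real k * (real k - 1) / (2 * real n)) * (fcoef z (k - 1) - fcoef z k)"
    have "(\<lambda>k. faber_coeff Psi h k * ?e k) sums (bernstein_faber G Psi h n z - h z - L z / of_nat n)"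
    proof -
      have "faber_coeff Psi h k * ?e k = faber_coeff Psi h k * (\<Sum>p\<le>k. of_real (occupancy n k p) * fcoef z p)
         - faber_coeff Psi h k * fcoef z k - voronovskaja_term h z k / of_nat n" for k
      proof -
        define x where "x = (of_real (real k * (real k - 1) / 2) :: complex)"
        have "of_real (real k * (real k - 1) / (2 * real n)) = x / of_nat n"
          by (simp add: x_def)
        then show ?thesis
          unfolding voronovskaja_term_def x_def[symmetric] by (simp add: algebra_simps diff_divide_distrib)
      qed
      then show ?thesis
        using sums_diff[OF sums_diff[OF bernstein_faber_sums[OF G h gt1(3) n, of z]
              faber_expansion[OF h less_imp_le[OF r(1)] r(2) z]] sums_divide[OF Ls[OF z], of "of_nat n"]]
        by simp
    qed
    moreover have "norm (\<Sum>k. faber_coeff Psi h k * ?e k)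
        \<le> (\<Sum>k. 4 * A * M * (real k ^ 4 * q ^ k) / real n ^ 2)"
    proof (rule norm_suminf_le[OF _ summable_divide[OF sm]])
      fix k
      have "norm (faber_coeff Psi h k * ?e k)
          \<le> (A / s' ^ k) * (4 * (real k ^ 4 / real n ^ 2) * (M * s ^ k))"
        unfolding norm_mult[of "faber_coeff Psi h k"] using A gt1
        by (intro mult_mono occupancy_expectation n M'[OF z]) auto
      also have "\<dots> = 4 * A * M * (real k ^ 4 * q ^ k) / real n ^ 2"
        by (simp add: q_def power_divide)
      finally show "norm (faber_coeff Psi h k * ?e k) \<le> 4 * A * M * (real k ^ 4 * q ^ k) / real n ^ 2" .
    qed
    ultimately show ?thesis
      using suminf_divide[OF sm, of "real n ^ 2"] by (simp add: sums_iff C_def)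
  qed
  then show ?thesis using that C0 Ls Lb by blast
qed

end


section \<open>Multiplication of the expansions of f and g and comparison with that of f g\<close>

theorem theorem6p1:
  fixes G :: "complex set" and Psi f g :: "complex \<Rightarrow> complex" and R r :: real
  assumes "compact G" and "connected G" and "\<not> (\<exists>a. G \<subseteq> {a})"
    and "connected (- G)"
    and "exterior_conformal_map G Psi"
    and "1 < R"
    and "f holomorphic_on GR Psi G R" and "g holomorphic_on GR Psi G R"
    and "\<forall>z\<in>GR Psi G R. (\<lambda>k. faber_coeff Psi f k * poly (faber_poly G Psi k) z) sums f z"
    and "\<forall>z\<in>GR Psi G R. (\<lambda>k. faber_coeff Psi g k * poly (faber_poly G Psi k) z) sums g z"
    and "\<forall>h\<in>{f, g, \<lambda>z. f z * g z}. continuous_on (cball 0 1) (assoc_ext Psi h)"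
    and "1 < r" and "r < R"
  shows "(\<exists>C. \<forall>n::nat. n \<ge> 1 \<longrightarrow> (\<forall>z\<in>closure (GR Psi G r).
            norm (bernstein_faber G Psi (\<lambda>z. f z * g z) n z
                  - bernstein_faber G Psi f n z * bernstein_faber G Psi g n z) \<le> C / real n))
       \<and> (\<exists>C. \<forall>n::nat. n \<ge> 1 \<longrightarrow> (\<forall>z\<in>closure (GR Psi G r).
            norm (bernstein_faber G Psi (\<lambda>z. f z * g z) n z
                  - bernstein_faber G Psi f n z * bernstein_faber G Psi g n z
                  - (\<Sum>j. (let k = j + 2 in
                       of_real (real k * (real k - 1) / (2 * real n))
                       * (poly (faber_poly G Psi (k - 1)) z - poly (faber_poly G Psi k) z)
                       * (faber_coeff Psi (\<lambda>z. f z * g z) k - f z * faber_coeff Psi g k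
                          - g z * faber_coeff Psi f k))))
            \<le> C / (real n) ^ 2))"
proof -
  obtain c :: real where c: "0 < c" "((\<lambda>w. Psi w / w) \<longlongrightarrow> complex_of_real c) at_infinity"
    using assms(5) unfolding exterior_conformal_map_def by blast
  interpret exterior_map G Psi "of_real c"
    using assms(5) c by unfold_locales (auto simp: exterior_conformal_map_def)
  have inf: "infinite G"
    using assms(2,3) connected_finite_iff_sing by blast
  have fg: "(\<lambda>z. f z * g z) holomorphic_on GR Psi G R"
    using assms(7,8) by (intro holomorphic_intros)
  let ?fg = "\<lambda>z. f z * g z" and ?B = "bernstein_faber G Psi" and ?K = "level_hull r"
  obtain Cf Lf where Cf: "0 \<le> Cf" "\<And>z. z \<in> ?K \<Longrightarrow> voronovskaja_term f z sums Lf z"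
    "\<And>z. z \<in> ?K \<Longrightarrow> norm (Lf z) \<le> Cf"
    "\<And>n z. 0 < n \<Longrightarrow> z \<in> ?K \<Longrightarrow> norm (?B f n z - f z - Lf z / of_nat n) \<le> Cf / real n ^ 2"
    by (rule bernstein_faber_expansion[OF inf assms(7) assms(12,13)]) blast
  obtain Cg Lg where Cg: "0 \<le> Cg" "\<And>z. z \<in> ?K \<Longrightarrow> voronovskaja_term g z sums Lg z"
    "\<And>z. z \<in> ?K \<Longrightarrow> norm (Lg z) \<le> Cg"
    "\<And>n z. 0 < n \<Longrightarrow> z \<in> ?K \<Longrightarrow> norm (?B g n z - g z - Lg z / of_nat n) \<le> Cg / real n ^ 2"
    by (rule bernstein_faber_expansion[OF inf assms(8) assms(12,13)]) blast
  obtain Ch Lh where Ch: "0 \<le> Ch" "\<And>z. z \<in> ?K \<Longrightarrow> voronovskaja_term ?fg z sums Lh z"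
    "\<And>z. z \<in> ?K \<Longrightarrow> norm (Lh z) \<le> Ch"
    "\<And>n z. 0 < n \<Longrightarrow> z \<in> ?K \<Longrightarrow> norm (?B ?fg n z - f z * g z - Lh z / of_nat n) \<le> Ch / real n ^ 2"
    by (rule bernstein_faber_expansion[OF inf fg assms(12,13)]) blast
  have bdd: "\<exists>K. \<forall>z\<in>?K. norm (h z) \<le> K" if "h holomorphic_on GR Psi G R" for h
  proof -
    have "continuous_on ?K h"
      using holomorphic_on_imp_continuous_on[OF that] level_hull_subset_GR[OF assms(13)]
      by (rule continuous_on_subset)
    then have "bounded (h ` ?K)"
      using compact_level_hull[of r] assms(12) by (intro compact_imp_bounded compact_continuous_image) auto
    then show ?thesis by (auto simp: bounded_iff)
  qed
  obtain Kf where Kf: "\<forall>z\<in>?K. norm (f z) \<le> Kf" using bdd[OF assms(7)] by blast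
  obtain Kg where Kg: "\<forall>z\<in>?K. norm (g z) \<le> Kg" using bdd[OF assms(8)] by blast
  define K where "K = Max {Kf, Kg, Cf, Cg, Ch}"
  have KK: "Kf \<le> K" "Kg \<le> K" "Cf \<le> K" "Cg \<le> K" "Ch \<le> K"
    by (auto simp: K_def)
  have K0: "0 \<le> K" using KK Cf(1) by linarith
  have bound: "norm (f z) \<le> K" "norm (g z) \<le> K" "norm (Lf z) \<le> K" "norm (Lg z) \<le> K" "norm (Lh z) \<le> K"
    if z: "z \<in> ?K" for z
    using order_trans[OF bspec[OF Kf z] KK(1)] order_trans[OF bspec[OF Kg z] KK(2)]
      order_trans[OF Cf(3)[OF z] KK(3)] order_trans[OF Cg(3)[OF z] KK(4)]
      order_trans[OF Ch(3)[OF z] KK(5)] by simp_all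
  \<comment> \<open>The coefficient of 1/n left after f(z) g(z) cancels, divided by n; it is the sum
    of the series in (ii), as shown in \<open>series\<close>.\<close>
  define S where "S n z = (Lh z - f z * Lg z - g z * Lf z) / of_nat n" for n z
  have main: "norm (?B ?fg n z - ?B f n z * ?B g n z - S n z) \<le> (K + 6 * K\<^sup>2) / real n ^ 2"
    if n: "0 < n" and z: "z \<in> ?K" for n z
  proof -
    define Ef where "Ef = ?B f n z - f z - Lf z / of_nat n"
    define Eg where "Eg = ?B g n z - g z - Lg z / of_nat n"
    define Eh where "Eh = ?B ?fg n z - f z * g z - Lh z / of_nat n"
    define lf where "lf = Lf z / of_nat n"
    define lg where "lg = Lg z / of_nat n"
    define lh where "lh = Lh z / of_nat n"
    have n1: "1 \<le> real n" using n by simp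
    have K2: "K / real n ^ 2 \<le> K" and K1: "K / real n \<le> K"
      using divide_left_mono[of 1 "real n" K] divide_left_mono[of 1 "real n ^ 2" K] n1 K0
      by (simp_all add: one_le_power)
    have E: "norm Ef \<le> K / real n ^ 2" "norm Eg \<le> K / real n ^ 2" "norm Eh \<le> K / real n ^ 2"
      unfolding Ef_def Eg_def Eh_def
      using order_trans[OF Cf(4)[OF n z] divide_right_mono[OF KK(3)]]
        order_trans[OF Cg(4)[OF n z] divide_right_mono[OF KK(4)]]
        order_trans[OF Ch(4)[OF n z] divide_right_mono[OF KK(5)]] by simp_all
    have l: "norm lf \<le> K / real n" "norm lg \<le> K / real n"
      unfolding lf_def lg_def using bound[OF z] by (simp_all add: norm_divide divide_right_mono)
    have B: "?B f n z = f z + lf + Ef" "?B g n z = g z + lg + Eg" "?B ?fg n z = f z * g z + lh + Eh"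
      unfolding Ef_def Eg_def Eh_def lf_def lg_def lh_def by simp_all
    have "S n z = lh - f z * lg - g z * lf"
      unfolding S_def lf_def lg_def lh_def by (simp add: diff_divide_distrib)
    \<comment> \<open>The terms of order 0 and 1 in 1/n cancel. What remains is \<open>Eh\<close>
      and six products, each at most K^2/n^2; hence the constant K + 6 K^2.\<close>
    then have "?B ?fg n z - ?B f n z * ?B g n z - S n z
        = Eh - (lf * lg + f z * Eg + g z * Ef + lf * Eg + lg * Ef + Ef * Eg)"
      unfolding B by (simp add: algebra_simps)
    also have "norm \<dots> \<le> norm Eh + (norm (lf * lg) + norm (f z * Eg) + norm (g z * Ef)
        + norm (lf * Eg) + norm (lg * Ef) + norm (Ef * Eg))"
      by (intro norm_triangle_le_diff norm_triangle_le add_mono order_refl)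
    also have "\<dots> \<le> K / real n ^ 2 + (K\<^sup>2 / real n ^ 2 + K\<^sup>2 / real n ^ 2 + K\<^sup>2 / real n ^ 2
        + K\<^sup>2 / real n ^ 2 + K\<^sup>2 / real n ^ 2 + K\<^sup>2 / real n ^ 2)"
    proof -
      have prod: "norm (x * y) \<le> K\<^sup>2 / real n ^ 2" if "norm x \<le> K" "norm y \<le> K / real n ^ 2" for x y :: complex
        using mult_mono[OF that K0 norm_ge_zero] by (simp add: norm_mult power2_eq_square)
      have "norm (lf * lg) \<le> K\<^sup>2 / real n ^ 2"
        using mult_mono[OF l _ norm_ge_zero] K0 by (simp add: norm_mult power2_eq_square)
      \<comment> \<open>As n \<ge> 1, these factors are also bounded by plain \<open>K\<close>, so
        in each mixed product one factor gives \<open>K\<close> and the other K/n^2.\<close>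
      moreover have "norm lf \<le> K" "norm lg \<le> K" "norm Ef \<le> K" using l E K1 K2 by linarith+
      note prod[OF bound(1)[OF z] E(2)] prod[OF bound(2)[OF z] E(1)]
        prod[OF this(1) E(2)] prod[OF this(2) E(1)] prod[OF this(3) E(2)]
      ultimately show ?thesis using E(3) by linarith
    qed
    also have "\<dots> = (K + 6 * K\<^sup>2) / real n ^ 2" by (simp add: add_divide_distrib)
    finally show ?thesis .
  qed
  have S: "norm (S n z) \<le> (K + 2 * K\<^sup>2) / real n" if n: "0 < n" and z: "z \<in> ?K" for n z
  proof -
    have "norm (Lh z - f z * Lg z - g z * Lf z) \<le> K + K * K + K * K"
      using bound[OF z] K0 by (intro norm_triangle_le_diff add_mono) (auto simp: norm_mult intro!: mult_mono)
    then show ?thesis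
      unfolding S_def norm_divide by (simp add: power2_eq_square divide_right_mono)
  qed
  have series: "(\<Sum>j. (let k = j + 2 in
       of_real (real k * (real k - 1) / (2 * real n))
       * (poly (faber_poly G Psi (k - 1)) z - poly (faber_poly G Psi k) z)
       * (faber_coeff Psi ?fg k - f z * faber_coeff Psi g k - g z * faber_coeff Psi f k))) = S n z"
    if z: "z \<in> ?K" for n z
  proof -
    define T where "T k = (voronovskaja_term ?fg z k - f z * voronovskaja_term g z k
        - g z * voronovskaja_term f z k) / of_nat n" for k
    have "T sums S n z"
      unfolding T_def S_def by (intro sums_divide sums_diff sums_mult Cf Cg Ch z)
    then have "(\<lambda>j. T (j + 2)) sums (S n z - (\<Sum>k<2. T k))"
      by (rule sums_split_initial_segment)
    \<comment> \<open>The factor k(k-1) vanishes at k = 0 and k = 1, so starting the series at k = 2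
      loses nothing.\<close>
    also have "(\<Sum>k<2. T k) = 0"
      by (simp add: numeral_2_eq_2 T_def voronovskaja_term_def)
    finally have "(\<Sum>j. T (j + 2)) = S n z"
      by (simp add: sums_iff)
    moreover have "T k = of_real (real k * (real k - 1) / (2 * real n))
       * (poly (faber_poly G Psi (k - 1)) z - poly (faber_poly G Psi k) z)
       * (faber_coeff Psi ?fg k - f z * faber_coeff Psi g k - g z * faber_coeff Psi f k)" for k
    proof -
      define x where "x = (of_real (real k * (real k - 1) / 2) :: complex)"
      have "of_real (real k * (real k - 1) / (2 * real n)) = x / of_nat n"
        by (simp add: x_def)
      then show ?thesis
        unfolding T_def voronovskaja_term_def poly_faber_poly[OF inf] x_def[symmetric]
        by (simp add: algebra_simps diff_divide_distrib add_divide_distrib)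
    qed
    ultimately show ?thesis by (simp only: Let_def)
  qed
  have cl: "z \<in> ?K" if "z \<in> closure (GR Psi G r)" for z
    using closure_GR[of r] assms(12) that by auto
  show ?thesis
  proof (rule conjI; rule exI; intro allI impI ballI)
    fix n z assume n: "1 \<le> (n::nat)" and "z \<in> closure (GR Psi G r)"
    then have z: "z \<in> ?K" "0 < n" using cl by auto
    have "norm (?B ?fg n z - ?B f n z * ?B g n z)
        \<le> (K + 6 * K\<^sup>2) / real n ^ 2 + (K + 2 * K\<^sup>2) / real n"
      using main[OF z(2,1)] S[OF z(2,1)]
        norm_triangle_ineq[of "?B ?fg n z - ?B f n z * ?B g n z - S n z" "S n z"] by simp
    \<comment> \<open>Claim (i) combines the second-order error, weakened from 1/n^2 to 1/n, with
      the bound on \<open>S\<close>.\<close>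
    also have "(K + 6 * K\<^sup>2) / real n ^ 2 \<le> (K + 6 * K\<^sup>2) / real n"
      using n K0 by (intro divide_left_mono) (auto simp: power2_eq_square)
    finally show "norm (?B ?fg n z - ?B f n z * ?B g n z) \<le> ((K + 6 * K\<^sup>2) + (K + 2 * K\<^sup>2)) / real n"
      by (simp add: add_divide_distrib)
  next
    fix n z assume n: "1 \<le> (n::nat)" and "z \<in> closure (GR Psi G r)"
    then have z: "z \<in> ?K" "0 < n" using cl by auto
    show "norm (?B ?fg n z - ?B f n z * ?B g n z
        - (\<Sum>j. (let k = j + 2 in
           of_real (real k * (real k - 1) / (2 * real n))
           * (poly (faber_poly G Psi (k - 1)) z - poly (faber_poly G Psi k) z)
           * (faber_coeff Psi ?fg k - f z * faber_coeff Psi g k - g z * faber_coeff Psi f k))))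
        \<le> (K + 6 * K\<^sup>2) / real n ^ 2"
      unfolding series[OF z(1)] by (rule main[OF z(2,1)])
  qed
qed

end
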